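(* In the DCSMD-SW setting described in the context, let the noise assumption, the network assumption, the boundedness assumption and the Bregman assumption hold, with tail parameter $\theta\ge \frac12$. Let the stepsizes be $\alpha_t=1/\sqrt{t+1}$, and for $\ell\in\mathcal V$ let $\widehat x_\ell^T=\frac{\sum_{t=1}^T\alpha_t x_{\ell,t}}{\sum_{t=1}^T\alpha_t}$. Then for any $\ell\in\mathcal V$ and any $0<\delta<1$, with probability at least $1-\delta$, $$F(\widehat x_{\ell}^T)-F(x^* )\leq \mathcal O\left(\Big(\log\frac{T}{\delta}\Big)^{2\theta}\frac{(\log T)^2}{\sqrt{T}}+\Big(\log\frac{1}{\delta}\Big)^2\Big(\log\frac{T}{\delta}\Big)^{2\max\{0,\theta-1\}}\frac{1}{\sqrt{T}}\right),$$ where $\mathcal O(\cdot)$ hides a positive constant factor independent of $T$ and $\delta$ (it may depend on the problem, network, noise and initialization data).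
   Context: Setting. $n,m$ are positive integers, $\mathcal V=\{1,\dots,m\}$, $\|\cdot\|$ is an arbitrary norm on $\mathbb R^n$, $\langle\cdot,\cdot\rangle$ the Euclidean inner product, and $\|z\|_*=\sup_{\|u\|\le1}|\langle z,u\rangle|$ the dual norm. $\mathcal X\subset\mathbb R^n$ is closed and convex (possibly unbounded); $f_i,\psi_i:\mathcal X\to\mathbb R$, $i\in\mathcal V$, are convex and possibly nonsmooth; $f=\sum_{i=1}^m f_i$, $\psi=\sum_{i=1}^m\psi_i$, $F=f+\psi$. A point $x^*\in\mathcal X$ with $F(x)\ge F(x^* )$ for all $x\in\mathcal X$ exists and is fixed. Bregman divergence. $D_\Phi(x\|y)=\Phi(x)-\Phi(y)-\langle\nabla\Phi(y),x-y\rangle$ for a distance-generating function $\Phi:\mathcal X\to\mathbb R$. Algorithm (DCSMD-SW). Given $m\times m$ communication matrices $W_t$ with nonnegative entries, edge sets $\mathcal E_t=\{(j,i):[W_t]_{ij}>0\}$, stepsizes $\alpha_t>0$ and deterministic initial points $x_{i,1}\in\mathcal X$, for $t\ge1$ and $i\in\mathcal V$: $$y_{i,t}=\sum_{j=1}^m[W_t]_{ij}x_{j,t},\qquad x_{i,t+1}=\arg\min_{x\in\mathcal X}\Big\{\langle\widehat g_{i,t}^{SW},x\rangle+\tfrac1{\alpha_t}D_\Phi(x\|y_{i,t})+\psi_i(x)\Big\},$$ where $\widehat g_{i,t}^{SW}=g_{i,t}-\xi_{i,t}$, $g_{i,t}\in\partial f_i(x_{i,t})$, $\mathbb E[\xi_{i,t}|\mathcal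 F_{t-1}]=0$, and $\mathcal F_t$ is the $\sigma$-field generated by the entire history of the randomness up to step $t$ (so $x_{i,t},y_{i,t},g_{i,t}$ are $\mathcal F_{t-1}$-measurable). Noise assumption: for some $\theta\ge\frac12$ there is $\kappa>0$ such that $\mathbb E[\exp\{(\|\xi_{i,t}\|_*/\kappa)^{1/\theta}\}\,|\,\mathcal F_{t-1}]\le2$ for all $t\ge1$, $i\in\mathcal V$. Network assumption: (a) each $W_t$ is doubly stochastic; (b) there is an integer $B\ge1$ such that the graph $(\mathcal V,\mathcal E_{kB+1}\cup\dots\cup\mathcal E_{(k+1)B})$ is strongly connected for every $k\ge0$; (c) there is $0<\eta<1$ with $[W_t]_{ii}\ge\eta$ for all $i,t$ and $[W_t]_{ij}\ge\eta$ whenever $(j,i)\in\mathcal E_t$. Boundedness assumption: there is $G>0$ with $\|g\|_*\le G$ for all $x\in\mathcal X$, $g\in\partial f_i(x)$, $i\in\mathcal V$; and there is $G_\psi>0$ such that every $\psi_i$ is convex with $|\psi_i(x)-\psi_i(y)|\le G_\psi\|x-y\|$ on $\mathcal X$. Bregman assumption: $\Phi$ is differentiable and $\sigma_\Phi$-strongly convex ($\sigma_\Phi>0$) with respect to $\|\cdot\|$ on $\mathcal X$, and $D_\Phi(x\|\sum_{j=1}^m a_jy_j)\le\sum_{j=1}^m a_jD_\Phi(x\|y_j)$ for all $x,y_j\in\mathcal X$, $a_j\ge0$, $\sum_{j=1}^m a_j=1$. Convention: the horizon $T$ is an integer with $T\ge10$. *)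

theory Defs
  imports "HOL-Probability.Probability" "Graph_Theory.Digraph_Component"
begin

text \<open>
  Vectors are elements of \<open>real ^ 'n\<close>, with \<open>\<bullet>\<close> the Euclidean inner product, and agents are
  elements of a finite type \<open>'m\<close>.  The norm \<open>N\<close> on \<open>real ^ 'n\<close> is an arbitrary one, unrelated to
  the Euclidean \<^const>\<open>norm\<close> of the type.
\<close>

definition is_norm :: "('a::real_vector \<Rightarrow> real) \<Rightarrow> bool" where
  "is_norm N \<longleftrightarrow>
     (\<forall>x. 0 \<le> N x) \<and> (\<forall>x. N x = 0 \<longleftrightarrow> x = 0) \<and>
     (\<forall>c x. N (c *\<^sub>R x) = \<bar>c\<bar> * N x) \<and> (\<forall>x y. N (x + y) \<le> N x + N y)"

definition dual_norm :: "('a::real_inner \<Rightarrow> real) \<Rightarrow> 'a \<Rightarrow> real" where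
  "dual_norm N z = (SUP u\<in>{u. N u \<le> 1}. \<bar>z \<bullet> u\<bar>)"

text \<open>
  The subdifferential of a function whose domain is the set \<open>D\<close>.  The domain matters at points of
  its boundary, where normal vectors of \<open>D\<close> can be added to a subgradient.
\<close>

definition subdifferential :: "'a::real_inner set \<Rightarrow> ('a \<Rightarrow> real) \<Rightarrow> 'a \<Rightarrow> 'a set" where
  "subdifferential D h x = {v. \<forall>z\<in>D. h z \<ge> h x + v \<bullet> (z - x)}"

definition strongly_convex_on ::
    "'a::real_vector set \<Rightarrow> ('a \<Rightarrow> real) \<Rightarrow> real \<Rightarrow> ('a \<Rightarrow> real) \<Rightarrow> bool" where
  "strongly_convex_on X N \<sigma> \<Phi> \<longleftrightarrow> convex X \<and>
     (\<forall>x\<in>X. \<forall>y\<in>X. \<forall>u\<ge>0. \<forall>v\<ge>0. u + v = 1 \<longrightarrow>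
        \<Phi> (u *\<^sub>R x + v *\<^sub>R y) \<le> u * \<Phi> x + v * \<Phi> y - \<sigma> / 2 * u * v * (N (x - y))\<^sup>2)"

text \<open>
  \<open>G\<Phi>\<close> is a gradient of \<open>\<Phi>\<close> on \<open>X\<close>.  Derivatives are taken within \<open>X\<close>, since \<open>\<Phi>\<close> is only given
  there; on a convex \<open>X\<close> the number \<open>G\<Phi> y \<bullet> (x - y)\<close> with \<open>x, y \<in> X\<close> does not depend on the
  choice of \<open>G\<Phi>\<close>.
\<close>

definition gradient_on ::
    "'a::real_inner set \<Rightarrow> ('a \<Rightarrow> real) \<Rightarrow> ('a \<Rightarrow> 'a) \<Rightarrow> bool" where
  "gradient_on X \<Phi> G\<Phi> \<longleftrightarrow> (\<forall>y\<in>X. (\<Phi> has_derivative (\<lambda>h. G\<Phi> y \<bullet> h)) (at y within X))"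

definition bregman :: "('a::real_inner \<Rightarrow> real) \<Rightarrow> ('a \<Rightarrow> 'a) \<Rightarrow> 'a \<Rightarrow> 'a \<Rightarrow> real" where
  "bregman \<Phi> G\<Phi> x y = \<Phi> x - \<Phi> y - G\<Phi> y \<bullet> (x - y)"

definition bregman_assumption ::
    "'m::finite itself \<Rightarrow> 'a::real_inner set \<Rightarrow> ('a \<Rightarrow> real) \<Rightarrow> real \<Rightarrow> ('a \<Rightarrow> real) \<Rightarrow>
     ('a \<Rightarrow> 'a) \<Rightarrow> bool" where
  "bregman_assumption (_ :: 'm itself) X N \<sigma> \<Phi> G\<Phi> \<longleftrightarrow>
     \<sigma> > 0 \<and> gradient_on X \<Phi> G\<Phi> \<and> strongly_convex_on X N \<sigma> \<Phi> \<and>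
     (\<forall>x\<in>X. \<forall>(y :: 'm \<Rightarrow> 'a) (a :: 'm \<Rightarrow> real).
        (\<forall>j. y j \<in> X) \<and> (\<forall>j. 0 \<le> a j) \<and> (\<Sum>j\<in>UNIV. a j) = 1 \<longrightarrow>
        bregman \<Phi> G\<Phi> x (\<Sum>j\<in>UNIV. a j *\<^sub>R y j) \<le> (\<Sum>j\<in>UNIV. a j * bregman \<Phi> G\<Phi> x (y j)))"

definition boundedness_assumption ::
    "'a::real_inner set \<Rightarrow> 'a set \<Rightarrow> ('a \<Rightarrow> real) \<Rightarrow> ('m \<Rightarrow> 'a \<Rightarrow> real) \<Rightarrow> ('m \<Rightarrow> 'a \<Rightarrow> real) \<Rightarrow>
     real \<Rightarrow> real \<Rightarrow> bool" where
  "boundedness_assumption X D N f \<psi> G G\<psi> \<longleftrightarrow>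
     G > 0 \<and> (\<forall>i. \<forall>x\<in>X. \<forall>v\<in>subdifferential D (f i) x. dual_norm N v \<le> G) \<and>
     G\<psi> > 0 \<and>
     (\<forall>i. convex_on X (\<psi> i) \<and> (\<forall>x\<in>X. \<forall>y\<in>X. \<bar>\<psi> i x - \<psi> i y\<bar> \<le> G\<psi> * N (x - y)))"

definition doubly_stochastic :: "real ^ 'm ^ 'm::finite \<Rightarrow> bool" where
  "doubly_stochastic A \<longleftrightarrow>
     (\<forall>i j. 0 \<le> A $ i $ j) \<and> (\<forall>i. (\<Sum>j\<in>UNIV. A $ i $ j) = 1) \<and> (\<forall>j. (\<Sum>i\<in>UNIV. A $ i $ j) = 1)"

definition comm_edges :: "real ^ 'm ^ 'm::finite \<Rightarrow> ('m \<times> 'm) set" where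
  "comm_edges A = {(j, i). A $ i $ j > 0}"

definition network_assumption :: "(nat \<Rightarrow> real ^ 'm ^ 'm::finite) \<Rightarrow> nat \<Rightarrow> real \<Rightarrow> bool" where
  "network_assumption W B \<eta> \<longleftrightarrow>
     (\<forall>t\<ge>1. doubly_stochastic (W t)) \<and>
     B \<ge> 1 \<and>
     (\<forall>k. strongly_connected
        \<lparr>verts = UNIV, arcs = (\<Union>t\<in>{k * B + 1..(k + 1) * B}. comm_edges (W t)),
         tail = fst, head = snd\<rparr>) \<and>
     0 < \<eta> \<and> \<eta> < 1 \<and>
     (\<forall>t\<ge>1. (\<forall>i. W t $ i $ i \<ge> \<eta>) \<and> (\<forall>i j. (j, i) \<in> comm_edges (W t) \<longrightarrow> W t $ i $ j \<ge> \<eta>))"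

definition mixed ::
    "(nat \<Rightarrow> real ^ 'm ^ 'm::finite) \<Rightarrow> ('m \<Rightarrow> nat \<Rightarrow> 'w \<Rightarrow> 'a::real_vector) \<Rightarrow> 'm \<Rightarrow> nat \<Rightarrow> 'w \<Rightarrow> 'a"
    where
  "mixed W x i t \<omega> = (\<Sum>j\<in>UNIV. W t $ i $ j *\<^sub>R x j t \<omega>)"

text \<open>
  Runs of the algorithm on the probability space \<open>M\<close>.  Here \<open>Fil t\<close> is the information up to
  step \<open>t\<close>; it may be any filtration for which the iterates and subgradients are predictable and
  the noise is adapted, in particular the one generated by the history.  All conditions on the
  processes concern \<open>t \<ge> 1\<close> only.  The vector-valued conditional expectation is taken
  componentwise.
\<close>

definition dcsmd_sw ::
    "(real ^ 'n::finite) set \<Rightarrow> (real ^ 'n) set \<Rightarrow> ('m::finite \<Rightarrow> real ^ 'n \<Rightarrow> real) \<Rightarrow>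
     ('m \<Rightarrow> real ^ 'n \<Rightarrow> real) \<Rightarrow> (real ^ 'n \<Rightarrow> real) \<Rightarrow> (real ^ 'n \<Rightarrow> real ^ 'n) \<Rightarrow>
     (nat \<Rightarrow> real ^ 'm ^ 'm) \<Rightarrow> (nat \<Rightarrow> real) \<Rightarrow> ('m \<Rightarrow> real ^ 'n) \<Rightarrow>
     'w measure \<Rightarrow> (nat \<Rightarrow> 'w measure) \<Rightarrow>
     ('m \<Rightarrow> nat \<Rightarrow> 'w \<Rightarrow> real ^ 'n) \<Rightarrow> ('m \<Rightarrow> nat \<Rightarrow> 'w \<Rightarrow> real ^ 'n) \<Rightarrow>
     ('m \<Rightarrow> nat \<Rightarrow> 'w \<Rightarrow> real ^ 'n) \<Rightarrow> bool" where
  "dcsmd_sw X D f \<psi> \<Phi> G\<Phi> W \<alpha> x1 M Fil x g \<xi> \<longleftrightarrow>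
     filtration (space M) Fil \<and> (\<forall>t. subalgebra M (Fil t)) \<and>
     (\<forall>i. \<forall>t\<ge>1. x i t \<in> borel_measurable (Fil (t - 1)) \<and> g i t \<in> borel_measurable (Fil (t - 1)) \<and>
        \<xi> i t \<in> borel_measurable (Fil t)) \<and>
     (\<forall>i. \<forall>\<omega>\<in>space M. x i 1 \<omega> = x1 i) \<and>
     (\<forall>i. \<forall>t\<ge>1. \<forall>\<omega>\<in>space M.
        g i t \<omega> \<in> subdifferential D (f i) (x i t \<omega>) \<and>
        is_arg_min
          (\<lambda>z. (g i t \<omega> - \<xi> i t \<omega>) \<bullet> z + 1 / \<alpha> t * bregman \<Phi> G\<Phi> z (mixed W x i t \<omega>) + \<psi> i z)
          (\<lambda>z. z \<in> X) (x i (t + 1) \<omega>)) \<and>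
     (\<forall>i. \<forall>t\<ge>1. integrable M (\<xi> i t) \<and>
        (\<forall>k. AE \<omega> in M. real_cond_exp M (Fil (t - 1)) (\<lambda>\<omega>'. \<xi> i t \<omega>' $ k) \<omega> = 0))"

definition noise_assumption ::
    "('a::real_inner \<Rightarrow> real) \<Rightarrow> real \<Rightarrow> real \<Rightarrow> 'w measure \<Rightarrow> (nat \<Rightarrow> 'w measure) \<Rightarrow>
     ('m \<Rightarrow> nat \<Rightarrow> 'w \<Rightarrow> 'a) \<Rightarrow> bool" where
  "noise_assumption N \<theta> \<kappa> M Fil \<xi> \<longleftrightarrow> \<theta> \<ge> 1 / 2 \<and> \<kappa> > 0 \<and>
     (\<forall>i. \<forall>t\<ge>1. AE \<omega> in M.
        nn_cond_exp M (Fil (t - 1))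
          (\<lambda>\<omega>'. ennreal (exp ((dual_norm N (\<xi> i t \<omega>') / \<kappa>) powr (1 / \<theta>)))) \<omega> \<le> 2)"

definition weighted_avg ::
    "(nat \<Rightarrow> real) \<Rightarrow> ('m \<Rightarrow> nat \<Rightarrow> 'w \<Rightarrow> 'a::real_vector) \<Rightarrow> 'm \<Rightarrow> nat \<Rightarrow> 'w \<Rightarrow> 'a" where
  "weighted_avg \<alpha> x l T \<omega> = (1 / (\<Sum>t=1..T. \<alpha> t)) *\<^sub>R (\<Sum>t=1..T. \<alpha> t *\<^sub>R x l t \<omega>)"

end

theory Submission
  imports Defs
begin

text \<open>
  The proof follows the energy \<open>\<Sum>i. D(x\<^sup>* \<parallel> x\<^sub>i\<^sub>,\<^sub>t)\<close>.  A mirror step lowers it by \<open>\<alpha>\<^sub>t\<close> times the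
  optimality gap, up to three errors (\<open>network_step\<close>): a term of order \<open>\<alpha>\<^sub>t\<^sup>2\<close> times the squared dual
  norm of the noisy subgradient, \<open>\<alpha>\<^sub>t\<close> times the disagreement of the agents, and the noise term
  \<open>\<alpha>\<^sub>t \<langle>\<xi>\<^sub>i\<^sub>,\<^sub>t, y\<^sub>i\<^sub>,\<^sub>t - x\<^sup>*\<rangle>\<close>.  Disagreement contracts by a fixed factor over every \<open>m B\<close> steps, because all
  entries of the product of that many mixing matrices are at least \<open>\<eta> ^ (m * B)\<close>; every step adds
  disagreement of order \<open>\<alpha>\<^sub>t\<close>, so the weighted sum of all disagreement is again of the order of the
  sum of the \<open>\<alpha>\<^sub>t\<^sup>2\<close>, that is, of \<open>log T\<close> (\<open>weighted_spread_sum\<close>).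

  The noise term is the real difficulty, for two reasons.  As \<open>X\<close> may be unbounded, there is no
  a-priori bound on \<open>y\<^sub>i\<^sub>,\<^sub>t - x\<^sup>*\<close>; and for \<open>\<theta> > 1\<close> the noise need not have exponential moments.  Let
  \<open>A = log (3 m T / \<delta>)\<close>.  Except with probability \<open>2 \<delta> / 3\<close>, all noise vectors up to time \<open>T\<close> have dual
  norm at most \<open>\<kappa> * A powr \<theta>\<close>.  The exponential of a sum of martingale differences,
  multiplied by the indicator that the noise has so far obeyed this bound, has bounded expectation:
  one factor of it is at most \<open>1 + w\<close> plus a multiple of the squared scale of \<open>w\<close> times the exponential
  quantity that the noise assumption controls (\<open>truncated_exp_le\<close>).  This inequality also holds where the
  indicator vanishes, so truncation creates no bias, and \<open>w\<close> integrates to zero.  Replacing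
  \<open>y\<^sub>i\<^sub>,\<^sub>t - x\<^sup>*\<close> by zero whenever its norm exceeds a number \<open>R\<close> keeps the scale of \<open>w\<close> bounded, and a
  Chernoff bound shows that all partial sums of the stopped noise terms are at most \<open>R K\<close> with
  \<open>K\<close> of order \<open>A powr max 0 (\<theta> - 1) * (A + log T)\<close> (\<open>stopped_sum_tail\<close>).

  On the resulting event the stopping is harmless (\<open>bootstrap\<close>).  While the distances
  are at most \<open>R\<close>, the energy is at most \<open>E + m K R\<close>, where \<open>E\<close> is of order
  \<open>A powr (2 * \<theta>) * log T\<close>.  If \<open>R\<close> is so large that this is at most \<open>\<sigma> R\<^sup>2 / 2\<close>, strong convexity
  of \<open>\<Phi>\<close> bounds the next distances by \<open>R\<close> as well, so the bound persists.  The same inequality bounds the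
  \<open>\<alpha>\<close>-weighted sum of the gaps by \<open>\<sigma> R\<^sup>2 / 2\<close>, which is of order \<open>K\<^sup>2 + E\<close>.  Dividing by the sum of
  the stepsizes, which is of order \<open>sqrt T\<close>, and splitting \<open>log (T / \<delta>)\<close> in \<open>K\<close> as
  \<open>log T + log (1 / \<delta>)\<close> gives the two terms of the rate (\<open>rate_bound\<close>).

  One point concerns the domain \<open>D\<close> of the \<open>f\<^sub>i\<close>: at its boundary, subgradients may be missing and
  \<open>f\<^sub>i\<close> may be discontinuous.  However, a nonempty subdifferential at a boundary point is
  unbounded, since outer normals of \<open>D\<close> can be added to its elements.  The bound \<open>G\<close> therefore forces every
  iterate of every agent into the interior of \<open>D\<close>, where each \<open>f\<^sub>j\<close> has subgradients and behaves
  like a \<open>G\<close>-Lipschitz function.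
\<close>

section \<open>Arbitrary norms and their duals\<close>

locale vector_norm =
  fixes N :: "'a::euclidean_space \<Rightarrow> real"
  assumes is_norm: "is_norm N"
begin

lemma nonneg [simp]: "0 \<le> N x"
  and eq_zero [simp]: "N x = 0 \<longleftrightarrow> x = 0"
  and scale: "N (c *\<^sub>R x) = \<bar>c\<bar> * N x"
  and triangle: "N (x + y) \<le> N x + N y"
  using is_norm unfolding is_norm_def by auto

lemma zero [simp]: "N 0 = 0"
  by simp

lemma minus [simp]: "N (- x) = N x"
  using scale[of "-1" x] by simp

lemma commute: "N (x - y) = N (y - x)"
  using minus[of "x - y"] by simp

lemma triangle_diff: "N (x - z) \<le> N (x - y) + N (y - z)"
  using triangle[of "x - y" "y - z"] by simp

lemma quadrangle: "N (x - y) \<le> N (x - u) + N (u - v) + N (y - v)"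
  using triangle_diff[of x y u] triangle_diff[of u y v] commute[of v y] by simp

lemma sum_le: "N (\<Sum>i\<in>A. h i) \<le> (\<Sum>i\<in>A. N (h i))"
proof (induction A rule: infinite_finite_induct)
  case (insert i A)
  then show ?case using triangle[of "h i" "sum h A"] by simp
qed auto

lemma convex_comb_le:
  assumes "\<And>j. j \<in> A \<Longrightarrow> 0 \<le> a j" "sum a A = 1" "\<And>j. j \<in> A \<Longrightarrow> N (v j) \<le> r"
  shows "N (\<Sum>j\<in>A. a j *\<^sub>R v j) \<le> r"
proof -
  have "N (\<Sum>j\<in>A. a j *\<^sub>R v j) \<le> (\<Sum>j\<in>A. N (a j *\<^sub>R v j))" by (rule sum_le)
  also have "\<dots> \<le> (\<Sum>j\<in>A. a j * r)"
    by (intro sum_mono) (use assms in \<open>auto simp: scale intro!: mult_left_mono\<close>)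
  finally show ?thesis using assms(2) by (simp flip: sum_distrib_right)
qed

lemma le_euclidean: "\<exists>c>0. \<forall>x. N x \<le> c * norm x"
proof (intro exI conjI allI)
  let ?c = "1 + (\<Sum>b\<in>Basis. N b)"
  show "0 < ?c" by (smt (verit) nonneg sum_nonneg)
  fix x
  have "N x = N (\<Sum>b\<in>Basis. (x \<bullet> b) *\<^sub>R b)" by (simp add: euclidean_representation)
  also have "\<dots> \<le> (\<Sum>b\<in>Basis. N ((x \<bullet> b) *\<^sub>R b))" by (rule sum_le)
  also have "\<dots> \<le> (\<Sum>b\<in>Basis. N b * norm x)"
    by (intro sum_mono) (auto simp: scale mult.commute[of _ "norm x"] Basis_le_norm intro!: mult_right_mono)
  also have "\<dots> \<le> ?c * norm x" by (simp add: distrib_right flip: sum_distrib_right)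
  finally show "N x \<le> ?c * norm x" .
qed

lemma continuous: "continuous_on S N"
proof -
  obtain c where c: "c > 0" "\<And>x. N x \<le> c * norm x" using le_euclidean by blast
  have "\<bar>N x - N y\<bar> \<le> c * norm (x - y)" for x y
    using triangle[of "x - y" y] triangle[of "y - x" x] c(2)[of "x - y"] commute[of x y] by simp
  then have "c-lipschitz_on S N" using c(1) by (auto simp: lipschitz_on_def dist_norm)
  then show ?thesis by (rule lipschitz_on_continuous_on)
qed

lemma euclidean_le: "\<exists>c>0. \<forall>x. norm x \<le> c * N x"
proof -
  have "sphere 0 1 \<noteq> ({} :: 'a set)" by simp
  then obtain u :: 'a where u: "u \<in> sphere 0 1" "\<And>v. v \<in> sphere 0 1 \<Longrightarrow> N u \<le> N v"
    using continuous_attains_inf[OF compact_sphere _ continuous] by blast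
  have "N u > 0" using u(1) by (metis eq_zero less_eq_real_def nonneg norm_zero mem_sphere_0 zero_neq_one)
  moreover have "norm x \<le> 1 / N u * N x" for x
  proof (cases "x = 0")
    case False
    then have "N u \<le> N ((1 / norm x) *\<^sub>R x)" by (intro u(2)) simp
    also have "\<dots> = N x / norm x" by (simp add: scale)
    finally show ?thesis using False \<open>N u > 0\<close> by (simp add: field_simps)
  qed simp
  ultimately show ?thesis by (intro exI[of _ "1 / N u"]) auto
qed

lemma dual_bdd: "\<exists>c>0. \<forall>z. \<forall>u\<in>{u. N u \<le> 1}. \<bar>z \<bullet> u\<bar> \<le> c * norm z"
proof -
  obtain c where c: "c > 0" "\<And>x. norm x \<le> c * N x" using euclidean_le by blast
  have "\<bar>z \<bullet> u\<bar> \<le> c * norm z" if "N u \<le> 1" for z u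
  proof -
    have "\<bar>z \<bullet> u\<bar> \<le> norm z * norm u" by (rule Cauchy_Schwarz_ineq2)
    also have "\<dots> \<le> norm z * c"
    proof (intro mult_left_mono)
      have "c * N u \<le> c" using that c(1) by (simp add: mult_left_le)
      then show "norm u \<le> c" using c(2)[of u] by linarith
    qed simp
    finally show ?thesis by (simp add: mult.commute)
  qed
  then show ?thesis using c(1) by auto
qed

lemma dual_bdd_above: "bdd_above ((\<lambda>u. \<bar>z \<bullet> u\<bar>) ` {u. N u \<le> 1})"
  using dual_bdd unfolding bdd_above_def by (metis (no_types, lifting) imageE)

lemma dual_upper: "N u \<le> 1 \<Longrightarrow> \<bar>z \<bullet> u\<bar> \<le> dual_norm N z"
  unfolding dual_norm_def by (intro cSUP_upper dual_bdd_above) auto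

lemma dual_least: "(\<And>u. N u \<le> 1 \<Longrightarrow> \<bar>z \<bullet> u\<bar> \<le> c) \<Longrightarrow> dual_norm N z \<le> c"
  unfolding dual_norm_def by (intro cSUP_least) (auto intro: exI[of _ 0])

lemma dual_nonneg [simp]: "0 \<le> dual_norm N z"
  using dual_upper[of 0 z] by simp

lemma dual_ineq: "\<bar>z \<bullet> u\<bar> \<le> dual_norm N z * N u"
proof (cases "u = 0")
  case False
  then have "N u > 0" by (metis eq_zero less_eq_real_def nonneg)
  have "\<bar>z \<bullet> ((1 / N u) *\<^sub>R u)\<bar> \<le> dual_norm N z"
    using \<open>N u > 0\<close> by (intro dual_upper) (simp add: scale)
  then show ?thesis using \<open>N u > 0\<close> by (simp add: abs_mult field_simps)
qed simp

lemma dual_ineq': "z \<bullet> u \<le> dual_norm N z * N u" "- (z \<bullet> u) \<le> dual_norm N z * N u"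
  using dual_ineq[of z u] by auto

lemma dual_triangle: "dual_norm N (z + w) \<le> dual_norm N z + dual_norm N w"
proof (rule dual_least)
  fix u assume "N u \<le> 1"
  then show "\<bar>(z + w) \<bullet> u\<bar> \<le> dual_norm N z + dual_norm N w"
    using dual_upper[of u z] dual_upper[of u w] by (simp add: inner_add_left)
qed

lemma dual_minus: "dual_norm N (- z) = dual_norm N z"
  unfolding dual_norm_def by simp

lemma dual_continuous: "continuous_on S (dual_norm N)"
proof -
  obtain c where c: "c > 0" "\<And>z u. N u \<le> 1 \<Longrightarrow> \<bar>z \<bullet> u\<bar> \<le> c * norm z" using dual_bdd by blast
  have le: "dual_norm N z \<le> c * norm z" for z by (intro dual_least c(2))
  have "\<bar>dual_norm N x - dual_norm N y\<bar> \<le> c * norm (x - y)" for x y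
    using dual_triangle[of "x - y" y] dual_triangle[of "y - x" x] le[of "x - y"]
      dual_minus[of "x - y"] by simp
  then have "c-lipschitz_on S (dual_norm N)" using c(1) by (auto simp: lipschitz_on_def dist_norm)
  then show ?thesis by (rule lipschitz_on_continuous_on)
qed

lemma measurable [measurable]: "N \<in> borel_measurable borel"
  by (intro borel_measurable_continuous_onI continuous)

lemma dual_measurable [measurable]: "dual_norm N \<in> borel_measurable borel"
  by (intro borel_measurable_continuous_onI dual_continuous)

end

section \<open>Subgradients\<close>

text \<open>
  A hyperplane separating \<open>(x, h x)\<close> from the strict epigraph of \<open>h\<close> is the graph of an affine minorant,
  provided that it is not vertical; a vertical one would separate \<open>x\<close> from \<open>D\<close>, which contains
  a neighbourhood of \<open>x\<close>.
\<close>

lemma subgradient_exists_interior: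
  fixes h :: "'a::euclidean_space \<Rightarrow> real"
  assumes cvx: "convex_on D h" and x: "x \<in> interior D"
  shows "\<exists>v. v \<in> subdifferential D h x"
proof -
  have xD: "x \<in> D" using x interior_subset by blast
  define E where "E = {(z, r). z \<in> D \<and> h z < r}"
  have "convex E"
  proof (rule convexI, clarsimp simp: E_def)
    fix z w :: 'a and r s u v :: real
    assume *: "z \<in> D" "h z < r" "w \<in> D" "h w < s" "0 \<le> u" "0 \<le> v" "u + v = 1"
    have "u *\<^sub>R z + v *\<^sub>R w \<in> D"
      using cvx * by (auto simp: convex_on_def intro: convexD)
    moreover have "h (u *\<^sub>R z + v *\<^sub>R w) \<le> u * h z + v * h w"
      using cvx * by (auto simp: convex_on_def)
    moreover have "u * h z + v * h w < u * r + v * s"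
    proof (cases "u = 0")
      case False
      then have "u * h z < u * r" "v * h w \<le> v * s" using * by (auto intro: mult_left_mono)
      then show ?thesis by linarith
    qed (use * in auto)
    ultimately show "u *\<^sub>R z + v *\<^sub>R w \<in> D \<and> h (u *\<^sub>R z + v *\<^sub>R w) < u * r + v * s" by linarith
  qed
  moreover have "(x, h x + 1) \<in> E" using xD by (simp add: E_def)
  moreover have "{(x, h x)} \<inter> E = {}" by (simp add: E_def)
  ultimately obtain p q where pq: "p \<noteq> 0" "p \<bullet> (x, h x) \<le> q" "\<And>e. e \<in> E \<Longrightarrow> q \<le> p \<bullet> e"
    using separating_hyperplane_sets[of "{(x, h x)}" E] by fastforce
  obtain a b where p: "p = (a, b)" by (cases p)
  have sep: "a \<bullet> x + b * h x \<le> a \<bullet> z + b * r" if "z \<in> D" "h z < r" for z r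
    using pq(2) pq(3)[of "(z, r)"] that by (auto simp: p E_def)
  have "b \<ge> 0" using sep[of x "h x + 1"] xD by (simp add: algebra_simps)
  moreover have "b \<noteq> 0"
  proof
    assume b: "b = 0"
    then have "a \<noteq> 0" using pq(1) p by (auto simp: zero_prod_def)
    obtain e where e: "e > 0" "cball x e \<subseteq> D" using x mem_interior_cball by blast
    \<comment> \<open>moving from \<open>x\<close> against \<open>a\<close> stays in \<open>D\<close> but violates the separation\<close>
    have "x - (e / norm a) *\<^sub>R a \<in> D"
      using e \<open>a \<noteq> 0\<close> by (intro subsetD[OF e(2)]) (simp add: dist_norm)
    then have "a \<bullet> ((e / norm a) *\<^sub>R a) \<le> 0"
      using b sep[of "x - (e / norm a) *\<^sub>R a" "h (x - (e / norm a) *\<^sub>R a) + 1"]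
      by (simp add: inner_diff_right)
    moreover have "a \<bullet> ((e / norm a) *\<^sub>R a) > 0" using \<open>a \<noteq> 0\<close> e by simp
    ultimately show False by linarith
  qed
  ultimately have b: "b > 0" by simp
  have "h x + (- (1 / b) *\<^sub>R a) \<bullet> (z - x) \<le> h z" if "z \<in> D" for z
  proof (rule dense_ge)
    fix r assume "h z < r"
    from sep[OF that this] show "h x + (- (1 / b) *\<^sub>R a) \<bullet> (z - x) \<le> r"
      using b by (simp add: field_simps inner_diff_right)
  qed
  then show ?thesis unfolding subdifferential_def by blast
qed

text \<open>
  At a point outside the interior there is a nonzero outer normal \<open>a\<close> of \<open>D\<close>, and with \<open>v\<close> every
  \<open>v + c *\<^sub>R a\<close>, \<open>c \<ge> 0\<close>, is a subgradient, so the subdifferential is unbounded.  A convex set with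
  empty interior lies in a hyperplane, whose normal then serves as \<open>a\<close>.
\<close>

lemma (in vector_norm) bounded_subdifferential_imp_interior:
  assumes "convex D" "x \<in> D" and v: "v \<in> subdifferential D h x"
    and bdd: "\<And>v. v \<in> subdifferential D h x \<Longrightarrow> dual_norm N v \<le> G"
  shows "x \<in> interior D"
proof (rule ccontr)
  assume not_int: "x \<notin> interior D"
  have "\<exists>a. a \<noteq> 0 \<and> (\<forall>z\<in>D. a \<bullet> z \<le> a \<bullet> x)"
  proof (cases "interior D = {}")
    case True
    from empty_interior_subset_hyperplane[OF \<open>convex D\<close> this] obtain a b
      where "a \<noteq> 0" "D \<subseteq> {x. a \<bullet> x = b}" .
    then have "\<forall>z\<in>D. a \<bullet> z = a \<bullet> x" using \<open>x \<in> D\<close> by blast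
    then show ?thesis using \<open>a \<noteq> 0\<close> by auto
  next
    case False
    have "{x} \<inter> interior D = {}" using not_int by simp
    with separating_hyperplane_sets[of "{x}" "interior D"] False \<open>convex D\<close>
    obtain a b where ab: "a \<noteq> 0" "a \<bullet> x \<le> b" "\<And>z. z \<in> interior D \<Longrightarrow> b \<le> a \<bullet> z"
      by (auto simp: convex_interior)
    have "closure (interior D) \<subseteq> {z. b \<le> a \<bullet> z}"
      by (rule closure_minimal) (use ab(3) closed_halfspace_ge[of b a] in auto)
    then have "D \<subseteq> {z. b \<le> a \<bullet> z}"
      using convex_closure_interior[OF \<open>convex D\<close> False] closure_subset by blast
    then have "\<forall>z\<in>D. (- a) \<bullet> z \<le> (- a) \<bullet> x" using ab(2) by force
    then show ?thesis using ab(1) by (intro exI[of _ "- a"]) auto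
  qed
  then obtain a where a: "a \<noteq> 0" "\<And>z. z \<in> D \<Longrightarrow> a \<bullet> z \<le> a \<bullet> x" by blast
  \<comment> \<open>large enough that \<open>v + c *\<^sub>R a\<close>, paired with \<open>a\<close>, exceeds \<open>\<bar>G\<bar> * N a\<close>\<close>
  define c where "c = (\<bar>G\<bar> * N a + \<bar>v \<bullet> a\<bar> + 1) / (a \<bullet> a)"
  have aa: "a \<bullet> a > 0" using a(1) by simp
  have c: "c \<ge> 0" "c * (a \<bullet> a) = \<bar>G\<bar> * N a + \<bar>v \<bullet> a\<bar> + 1" using aa by (auto simp: c_def)
  have "v + c *\<^sub>R a \<in> subdifferential D h x"
    unfolding subdifferential_def
  proof (intro CollectI ballI)
    fix z assume z: "z \<in> D"
    have "c * (a \<bullet> (z - x)) \<le> 0" using a(2)[OF z] c(1) by (simp add: mult_nonneg_nonpos inner_diff_right)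
    moreover have "h x + v \<bullet> (z - x) \<le> h z" using v z by (auto simp: subdifferential_def)
    ultimately show "h x + (v + c *\<^sub>R a) \<bullet> (z - x) \<le> h z" by (simp add: inner_add_left)
  qed
  then have "dual_norm N (v + c *\<^sub>R a) \<le> \<bar>G\<bar>" using bdd by force
  then have "(v + c *\<^sub>R a) \<bullet> a \<le> \<bar>G\<bar> * N a"
    using dual_ineq'(1)[of "v + c *\<^sub>R a" a] by (meson mult_right_mono nonneg order_trans)
  then show False using c by (simp add: inner_add_left)
qed

lemma (in vector_norm) subgradient_Lipschitz:
  assumes "v \<in> subdifferential D h x" "dual_norm N v \<le> G" "z \<in> D"
  shows "h x - h z \<le> G * N (x - z)"
proof -
  have "h x - h z \<le> - (v \<bullet> (z - x))" using assms by (auto simp: subdifferential_def)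
  also have "\<dots> \<le> dual_norm N v * N (z - x)" by (rule dual_ineq')
  also have "\<dots> \<le> G * N (x - z)" using assms by (simp add: commute mult_right_mono)
  finally show ?thesis .
qed

section \<open>Bregman divergences and the mirror step\<close>

text \<open>
  The derivative within \<open>X\<close> is only informative along segments of \<open>X\<close>; composing with the segment from
  \<open>y\<close> to \<open>x\<close> reduces it to a one-sided derivative of a function of one real variable.
\<close>

lemma gradient_on_directional:
  assumes "gradient_on X \<Phi> G\<Phi>" "convex X" "y \<in> X" "x \<in> X"
  shows "((\<lambda>s. (\<Phi> (y + s *\<^sub>R (x - y)) - \<Phi> y) / s) \<longlongrightarrow> G\<Phi> y \<bullet> (x - y)) (at_right 0)"
proof -
  define q where "q = (\<lambda>s::real. y + s *\<^sub>R (x - y))"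
  have q: "(q has_derivative (\<lambda>s. s *\<^sub>R (x - y))) (at 0 within {0..1})"
    unfolding q_def by (auto intro!: derivative_eq_intros)
  have "q s \<in> X" if "s \<in> {0..1}" for s
  proof -
    have "q s = (1 - s) *\<^sub>R y + s *\<^sub>R x" by (simp add: q_def algebra_simps)
    then show ?thesis using that assms by (auto intro: convexD)
  qed
  then have sub: "q ` {0..1} \<subseteq> X" by blast
  have "(\<Phi> has_derivative (\<lambda>h. G\<Phi> y \<bullet> h)) (at (q 0) within q ` {0..1})"
    using assms sub by (auto simp: gradient_on_def q_def intro: has_derivative_subset)
  from diff_chain_within[OF q this]
  have "((\<Phi> \<circ> q) has_derivative (\<lambda>s. (G\<Phi> y \<bullet> (x - y)) * s)) (at 0 within {0..1})"
    by (simp add: o_def mult.commute)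
  then have "((\<Phi> \<circ> q) has_field_derivative (G\<Phi> y \<bullet> (x - y))) (at 0 within {0..1})"
    by (simp add: has_field_derivative_def)
  then have "((\<lambda>s. (\<Phi> (q s) - \<Phi> y) / s) \<longlongrightarrow> G\<Phi> y \<bullet> (x - y)) (at 0 within {0..1})"
    by (simp add: has_field_derivative_iff q_def)
  then show ?thesis by (simp add: q_def at_within_Icc_at_right)
qed

lemma bregman_lower_bound:
  assumes "gradient_on X \<Phi> G\<Phi>" "strongly_convex_on X N \<sigma> \<Phi>" "x \<in> X" "y \<in> X"
  shows "\<sigma> / 2 * (N (x - y))\<^sup>2 \<le> bregman \<Phi> G\<Phi> x y"
proof -
  have cvx: "convex X" using assms by (simp add: strongly_convex_on_def)
  let ?c = "\<sigma> / 2 * (N (x - y))\<^sup>2"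
  have "\<forall>\<^sub>F s in at_right 0. (\<Phi> (y + s *\<^sub>R (x - y)) - \<Phi> y) / s \<le> \<Phi> x - \<Phi> y - ?c * (1 - s)"
    using eventually_at_right_real[of 0 1]
  proof (rule eventually_mono)
    show "(0::real) < 1" by simp
    fix s :: real assume "s \<in> {0<..<1}"
    then have s: "0 < s" "s < 1" by auto
    have "\<Phi> (s *\<^sub>R x + (1 - s) *\<^sub>R y)
        \<le> s * \<Phi> x + (1 - s) * \<Phi> y - \<sigma> / 2 * s * (1 - s) * (N (x - y))\<^sup>2"
      using assms s unfolding strongly_convex_on_def by simp
    also have "s *\<^sub>R x + (1 - s) *\<^sub>R y = y + s *\<^sub>R (x - y)" by (simp add: algebra_simps)
    finally have "\<Phi> (y + s *\<^sub>R (x - y)) - \<Phi> y \<le> s * (\<Phi> x - \<Phi> y - ?c * (1 - s))"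
      by (simp add: algebra_simps)
    then show "(\<Phi> (y + s *\<^sub>R (x - y)) - \<Phi> y) / s \<le> \<Phi> x - \<Phi> y - ?c * (1 - s)"
      using s by (simp add: divide_le_eq mult.commute)
  qed
  moreover have "((\<lambda>s. \<Phi> x - \<Phi> y - ?c * (1 - s)) \<longlongrightarrow> \<Phi> x - \<Phi> y - ?c * (1 - 0)) (at_right 0)"
    by (intro tendsto_intros)
  ultimately have "G\<Phi> y \<bullet> (x - y) \<le> \<Phi> x - \<Phi> y - ?c * (1 - 0)"
    by (intro tendsto_le[OF _ _ gradient_on_directional[OF assms(1) cvx assms(4,3)]]) auto
  then show ?thesis by (simp add: bregman_def)
qed

text \<open>
  The three-point inequality.  The linear term and \<open>\<psi>\<close> are convex and \<open>\<Phi>\<close> has a directional derivative at \<open>p\<close>,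
  so comparing the minimiser \<open>p\<close> with \<open>p + s *\<^sub>R (x - p)\<close> and letting \<open>s\<close> tend to 0 gives the first-order
  optimality condition; the identity between the three divergences turns it into this form.
\<close>

lemma mirror_step:
  assumes grad: "gradient_on X \<Phi> G\<Phi>" and cvx: "convex X" and psi: "convex_on X \<psi>"
    and \<alpha>: "\<alpha> > 0" and y: "y \<in> X" and x: "x \<in> X"
    and min: "is_arg_min (\<lambda>z. v \<bullet> z + 1 / \<alpha> * bregman \<Phi> G\<Phi> z y + \<psi> z) (\<lambda>z. z \<in> X) p"
  shows "\<alpha> * (v \<bullet> (p - x) + (\<psi> p - \<psi> x))
    \<le> bregman \<Phi> G\<Phi> x y - bregman \<Phi> G\<Phi> x p - bregman \<Phi> G\<Phi> p y"
proof -
  have p: "p \<in> X" using min by (simp add: is_arg_min_def)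
  let ?k = "\<alpha> * (v \<bullet> (p - x) + (\<psi> p - \<psi> x)) + G\<Phi> y \<bullet> (x - p)"
  have "\<forall>\<^sub>F s in at_right 0. ?k \<le> (\<Phi> (p + s *\<^sub>R (x - p)) - \<Phi> p) / s"
    using eventually_at_right_real[of 0 1]
  proof (rule eventually_mono)
    show "(0::real) < 1" by simp
    fix s :: real assume "s \<in> {0<..<1}"
    then have s: "0 < s" "s < 1" by auto
    define z where "z = p + s *\<^sub>R (x - p)"
    have z_eq: "z = (1 - s) *\<^sub>R p + s *\<^sub>R x" by (simp add: z_def algebra_simps)
    have "z \<in> X" using s cvx p x by (auto simp: z_eq intro: convexD)
    then have "v \<bullet> p + 1 / \<alpha> * bregman \<Phi> G\<Phi> p y + \<psi> p \<le> v \<bullet> z + 1 / \<alpha> * bregman \<Phi> G\<Phi> z y + \<psi> z"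
      using min by (force simp: is_arg_min_def)
    then have "\<alpha> * (v \<bullet> p + 1 / \<alpha> * bregman \<Phi> G\<Phi> p y + \<psi> p)
        \<le> \<alpha> * (v \<bullet> z + 1 / \<alpha> * bregman \<Phi> G\<Phi> z y + \<psi> z)" using \<alpha> by simp
    then have "\<alpha> * (v \<bullet> p) + bregman \<Phi> G\<Phi> p y + \<alpha> * \<psi> p \<le> \<alpha> * (v \<bullet> z) + bregman \<Phi> G\<Phi> z y + \<alpha> * \<psi> z"
      using \<alpha> by (simp add: distrib_left)
    moreover have "\<alpha> * \<psi> z \<le> \<alpha> * ((1 - s) * \<psi> p + s * \<psi> x)"
      using psi p x s \<alpha> by (intro mult_left_mono) (auto simp: z_eq convex_on_def)
    ultimately have "s * ?k \<le> \<Phi> z - \<Phi> p"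
      by (simp add: bregman_def z_def algebra_simps)
    then show "?k \<le> (\<Phi> (p + s *\<^sub>R (x - p)) - \<Phi> p) / s"
      using s by (simp add: z_def le_divide_eq mult.commute)
  qed
  then have "?k \<le> G\<Phi> p \<bullet> (x - p)"
    by (intro tendsto_lowerbound[OF gradient_on_directional[OF grad cvx p x]]) auto
  then show ?thesis by (simp add: bregman_def algebra_simps)
qed

text \<open>
  This is the three-point inequality with \<open>x = y\<close>: the two divergences that remain are quadratic in
  the length of the step, whereas the left-hand side is linear in it.
\<close>

lemma (in vector_norm) mirror_step_length:
  assumes grad: "gradient_on X \<Phi> G\<Phi>" and sc: "strongly_convex_on X N \<sigma> \<Phi>" "\<sigma> > 0"
    and psi: "convex_on X \<psi>" "\<And>x y. x \<in> X \<Longrightarrow> y \<in> X \<Longrightarrow> \<bar>\<psi> x - \<psi> y\<bar> \<le> L * N (x - y)"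
    and L: "L \<ge> 0" and \<alpha>: "\<alpha> > 0" and y: "y \<in> X"
    and min: "is_arg_min (\<lambda>z. v \<bullet> z + 1 / \<alpha> * bregman \<Phi> G\<Phi> z y + \<psi> z) (\<lambda>z. z \<in> X) p"
  shows "\<sigma> * N (p - y) \<le> \<alpha> * (dual_norm N v + L)"
proof (cases "p = y")
  case True
  then show ?thesis using \<alpha> L by simp
next
  case False
  then have pos: "N (p - y) > 0" by (metis eq_iff_diff_eq_0 eq_zero less_eq_real_def nonneg)
  have cvx: "convex X" using sc by (simp add: strongly_convex_on_def)
  have p: "p \<in> X" using min by (simp add: is_arg_min_def)
  have "\<alpha> * (v \<bullet> (p - y) + (\<psi> p - \<psi> y)) \<le> bregman \<Phi> G\<Phi> y y - bregman \<Phi> G\<Phi> y p - bregman \<Phi> G\<Phi> p y"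
    by (rule mirror_step[OF grad cvx psi(1) \<alpha> y y min])
  also have "\<dots> \<le> - \<sigma> * (N (p - y))\<^sup>2"
    using bregman_lower_bound[OF grad sc(1) p y] bregman_lower_bound[OF grad sc(1) y p]
    by (simp add: bregman_def commute[of y p])
  finally have "\<sigma> * (N (p - y))\<^sup>2 \<le> \<alpha> * (- (v \<bullet> (p - y)) + (\<psi> y - \<psi> p))"
    by (simp add: algebra_simps)
  also have "\<dots> \<le> \<alpha> * (dual_norm N v * N (p - y) + L * N (p - y))"
    using psi(2)[OF p y] \<alpha> dual_ineq'(2)[of v "p - y"] by (intro mult_left_mono) auto
  finally have "(\<sigma> * N (p - y)) * N (p - y) \<le> (\<alpha> * (dual_norm N v + L)) * N (p - y)"
    by (simp add: algebra_simps power2_eq_square)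
  then show ?thesis using pos by simp
qed

section \<open>Consensus over the time-varying network\<close>

text \<open>
  Otherwise the proper nonempty set \<open>S\<close> would be closed under the arcs, and no path could leave it.
\<close>

lemma strongly_connected_crossing_arc:
  assumes "strongly_connected \<lparr>verts = UNIV, arcs = E, tail = fst, head = snd\<rparr>"
    and "i0 \<in> S" "S \<noteq> UNIV"
  shows "\<exists>(j, i)\<in>E. j \<in> S \<and> i \<notin> S"
proof (rule ccontr)
  let ?G = "\<lparr>verts = UNIV, arcs = E, tail = fst, head = snd\<rparr>"
  assume no: "\<not> ?thesis"
  obtain i where "i \<notin> S" using \<open>S \<noteq> UNIV\<close> by blast
  have "i0 \<rightarrow>\<^sup>*\<^bsub>?G\<^esub> i" using assms(1) by (simp add: strongly_connected_def)
  then have "(i0, i) \<in> (arcs_ends ?G)\<^sup>*" by (rule reachable_rtranclI)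
  then have "i \<in> S"
  proof (induction rule: rtrancl_induct)
    case base
    show ?case by fact
  next
    case (step j k)
    then have "(j, k) \<in> E" by (auto simp: arcs_ends_def arc_to_ends_def)
    then show ?case using no step by blast
  qed
  with \<open>i \<notin> S\<close> show False ..
qed

text \<open>
  The product \<open>W (t + s - 1) ** \<dots> ** W t\<close>, which maps the noiseless states at time \<open>t\<close> to those at
  time \<open>t + s\<close>.
\<close>

fun transition :: "(nat \<Rightarrow> real ^ 'm ^ 'm::finite) \<Rightarrow> nat \<Rightarrow> nat \<Rightarrow> real ^ 'm ^ 'm" where
  "transition W t 0 = mat 1"
| "transition W t (Suc s) = W (t + s) ** transition W t s"

locale network =
  fixes W :: "nat \<Rightarrow> real ^ 'm ^ 'm::finite" and B :: nat and \<eta> :: real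
  assumes network: "network_assumption W B \<eta>"
begin

lemma weight_nonneg: "t \<ge> 1 \<Longrightarrow> 0 \<le> W t $ i $ j"
  and row_sum: "t \<ge> 1 \<Longrightarrow> (\<Sum>j\<in>UNIV. W t $ i $ j) = 1"
  and column_sum: "t \<ge> 1 \<Longrightarrow> (\<Sum>i\<in>UNIV. W t $ i $ j) = 1"
  and B_pos: "B \<ge> 1" and eta: "0 < \<eta>" "\<eta> < 1"
  and diagonal: "t \<ge> 1 \<Longrightarrow> \<eta> \<le> W t $ i $ i"
  and off_diagonal: "t \<ge> 1 \<Longrightarrow> (j, i) \<in> comm_edges (W t) \<Longrightarrow> \<eta> \<le> W t $ i $ j"
  and window_connected: "strongly_connected
        \<lparr>verts = UNIV, arcs = (\<Union>t\<in>{k * B + 1..(k + 1) * B}. comm_edges (W t)),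
         tail = fst, head = snd\<rparr>"
  using network unfolding network_assumption_def doubly_stochastic_def by auto

lemma transition_nonneg: "t \<ge> 1 \<Longrightarrow> 0 \<le> transition W t s $ i $ j"
proof (induction s arbitrary: i j)
  case (Suc s)
  then show ?case by (auto simp: matrix_matrix_mult_def intro!: sum_nonneg mult_nonneg_nonneg weight_nonneg)
qed (auto simp: mat_def)

lemma transition_row_sum: "t \<ge> 1 \<Longrightarrow> (\<Sum>j\<in>UNIV. transition W t s $ i $ j) = 1"
proof (induction s arbitrary: i)
  case (Suc s)
  have "(\<Sum>j\<in>UNIV. transition W t (Suc s) $ i $ j)
      = (\<Sum>k\<in>UNIV. W (t + s) $ i $ k * (\<Sum>j\<in>UNIV. transition W t s $ k $ j))"
    by (simp add: matrix_matrix_mult_def sum_distrib_left) (rule sum.swap)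
  then show ?case using Suc row_sum[of "t + s"] by simp
qed (simp add: mat_def)

text \<open>
  The agents on which agent \<open>j0\<close> has gained a guaranteed influence after \<open>s\<close> steps from time \<open>t\<close>.
  The threshold loses a factor \<open>\<eta>\<close> per step, a lower bound for the weight of every edge.
\<close>

definition reached :: "nat \<Rightarrow> nat \<Rightarrow> 'm \<Rightarrow> 'm set" where
  "reached t s j0 = {i. \<eta> ^ s \<le> transition W t s $ i $ j0}"

lemma reached_edge:
  assumes t: "t \<ge> 1" and k: "k \<in> reached t s j0" and w: "\<eta> \<le> W (t + s) $ i $ k"
  shows "i \<in> reached t (Suc s) j0"
proof -
  have "\<eta> * \<eta> ^ s \<le> W (t + s) $ i $ k * transition W t s $ k $ j0"
    using k w eta by (intro mult_mono) (auto simp: reached_def)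
  also have "\<dots> \<le> (\<Sum>k\<in>UNIV. W (t + s) $ i $ k * transition W t s $ k $ j0)"
    using t by (intro member_le_sum) (auto intro!: mult_nonneg_nonneg weight_nonneg transition_nonneg)
  finally show ?thesis by (simp add: reached_def matrix_matrix_mult_def)
qed

lemma reached_mono: 
  assumes "t \<ge> 1" "s \<le> s'"
  shows "reached t s j0 \<subseteq> reached t s' j0"
  using assms(2)
proof (induction s' rule: dec_induct)
  case (step n)
  then show ?case using reached_edge[OF assms(1), of _ n] diagonal assms(1) by fastforce
qed simp

text \<open>
  Within a window of \<open>B\<close> steps some edge leaves the reached set as it was at the start of the window; at the
  time when this edge is active its source is still reached, thanks to the self-loops.
\<close>

lemma reached_grows:
  assumes "k * B + 1 = t + s" "t \<ge> 1" "j0 \<in> reached t s j0" "reached t s j0 \<noteq> UNIV"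
  shows "reached t s j0 \<subset> reached t (s + B) j0"
proof -
  obtain j i r where r: "r \<in> {k * B + 1..(k + 1) * B}" "(j, i) \<in> comm_edges (W r)"
      and ji: "j \<in> reached t s j0" "i \<notin> reached t s j0"
    using strongly_connected_crossing_arc[OF window_connected assms(3,4)] by blast
  define s' where "s' = r - t"
  have s': "r = t + s'" "s \<le> s'" "Suc s' \<le> s + B" using r(1) assms(1) by (auto simp: s'_def)
  have "j \<in> reached t s' j0" using reached_mono[OF assms(2) s'(2)] ji by blast
  then have "i \<in> reached t (Suc s') j0"
    using reached_edge[OF assms(2)] off_diagonal[OF _ r(2)] s' assms(2) by simp
  then have "i \<in> reached t (s + B) j0" using reached_mono[OF assms(2) s'(3)] by blast
  then show ?thesis using ji reached_mono[OF assms(2), of s "s + B"] by auto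
qed

text \<open>
  The reached set gains at least one agent per window, so it is everything after \<open>CARD('m)\<close> windows.
\<close>

lemma transition_period_lower_bound:
  "\<eta> ^ (CARD('m) * B) \<le> transition W (k * B + 1) (CARD('m) * B) $ i $ j0"
proof -
  let ?t = "k * B + 1"
  have base: "j0 \<in> reached ?t 0 j0" by (simp add: reached_def mat_def)
  then have self: "j0 \<in> reached ?t s j0" for s using reached_mono[of ?t 0 s] by auto
  have "reached ?t (n * B) j0 = UNIV \<or> n < card (reached ?t (n * B) j0)" for n
  proof (induction n)
    case 0
    then show ?case using base by (auto simp: card_gt_0_iff)
  next
    case (Suc n)
    show ?case
    proof (cases "reached ?t (n * B) j0 = UNIV")
      case True
      then show ?thesis using reached_mono[of ?t "n * B" "Suc n * B" j0] by auto
    next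
      case False
      have "reached ?t (n * B) j0 \<subset> reached ?t (n * B + B) j0"
        by (rule reached_grows[where k = "k + n"]) (use False self in \<open>auto simp: algebra_simps\<close>)
      then have "card (reached ?t (n * B) j0) < card (reached ?t (Suc n * B) j0)"
        by (intro psubset_card_mono) (auto simp: add.commute)
      then show ?thesis using Suc False by linarith
    qed
  qed
  from this[of "CARD('m)"] have "reached ?t (CARD('m) * B) j0 = UNIV"
    using card_mono[of UNIV "reached ?t (CARD('m) * B) j0"] by auto
  then show ?thesis by (auto simp: reached_def)
qed

end

definition spread :: "('a::real_vector \<Rightarrow> real) \<Rightarrow> ('m::finite \<Rightarrow> 'a) \<Rightarrow> real" where
  "spread N z = Max (range (\<lambda>(i, j). N (z i - z j)))"

lemma spread_upper: "N (z i - z j) \<le> spread N z"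
  unfolding spread_def by (rule Max_ge) auto

lemma spread_least: "(\<And>i j. N (z i - z j) \<le> r) \<Longrightarrow> spread N z \<le> r"
  unfolding spread_def by (subst Max_le_iff) auto

locale normed_network = network W B \<eta> + vector_norm N
  for W :: "nat \<Rightarrow> real ^ 'm ^ 'm::finite" and B \<eta>
    and N :: "'a::euclidean_space \<Rightarrow> real"
begin

lemma spread_nonneg: "0 \<le> spread N z"
  by (rule order_trans[OF nonneg spread_upper])

text \<open>
  Both averages put weight at least \<open>c\<close> on the same point \<open>z j0\<close>.  This common part cancels in the
  difference; what remains is \<open>1 - c\<close> times a difference of two averages, which is at most the spread.
\<close>

lemma averages_close:
  fixes j0 :: 'm
  assumes "\<And>j. 0 \<le> a j" "sum a UNIV = 1" "\<And>j. 0 \<le> b j" "sum b UNIV = 1"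
    and c: "0 \<le> c" "c < 1" "c \<le> a j0" "c \<le> b j0"
  shows "N ((\<Sum>j\<in>UNIV. a j *\<^sub>R z j) - (\<Sum>j\<in>UNIV. b j *\<^sub>R z j)) \<le> (1 - c) * spread N z"
proof -
  define rest where "rest d j = (d j - (if j = j0 then c else 0)) / (1 - c)" for d and j :: 'm
  have rest: "rest d j \<ge> 0" "sum (rest d) UNIV = 1"
      "(\<Sum>j\<in>UNIV. d j *\<^sub>R z j) = c *\<^sub>R z j0 + (1 - c) *\<^sub>R (\<Sum>j\<in>UNIV. rest d j *\<^sub>R z j)"
    if "\<And>j. 0 \<le> d j" "sum d UNIV = 1" "c \<le> d j0" for d j
  proof -
    show "rest d j \<ge> 0" using that c by (auto simp: rest_def)
    show "sum (rest d) UNIV = 1"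
      using that c by (simp add: rest_def sum_subtractf flip: sum_divide_distrib)
    have "(1 - c) *\<^sub>R (\<Sum>j\<in>UNIV. rest d j *\<^sub>R z j)
        = (\<Sum>j\<in>UNIV. (d j - (if j = j0 then c else 0)) *\<^sub>R z j)"
      using c by (simp add: rest_def scaleR_sum_right)
    also have "\<dots> = (\<Sum>j\<in>UNIV. d j *\<^sub>R z j) - (\<Sum>j\<in>UNIV. (if j = j0 then c *\<^sub>R z j else 0))"
      by (subst sum_subtractf[symmetric]) (auto simp: algebra_simps intro!: sum.cong)
    finally show "(\<Sum>j\<in>UNIV. d j *\<^sub>R z j) = c *\<^sub>R z j0 + (1 - c) *\<^sub>R (\<Sum>j\<in>UNIV. rest d j *\<^sub>R z j)"
      by simp
  qed
  let ?A = "\<Sum>j\<in>UNIV. rest a j *\<^sub>R z j" and ?B = "\<Sum>j\<in>UNIV. rest b j *\<^sub>R z j"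
  have "N (z i - ?B) \<le> spread N z" for i
  proof -
    have "z i - ?B = (\<Sum>j\<in>UNIV. rest b j *\<^sub>R (z i - z j))"
      using rest(2)[of b] assms by (simp add: scaleR_diff_right sum_subtractf flip: scaleR_sum_left)
    also have "N \<dots> \<le> spread N z"
      by (rule convex_comb_le) (use rest(1,2)[of b] assms spread_upper in auto)
    finally show ?thesis .
  qed
  moreover have "?A - ?B = (\<Sum>i\<in>UNIV. rest a i *\<^sub>R (z i - ?B))"
    using rest(2)[of a] assms by (simp add: scaleR_diff_right sum_subtractf flip: scaleR_sum_left)
  ultimately have "N (?A - ?B) \<le> spread N z"
    using rest(1,2)[of a] assms by (auto intro!: convex_comb_le)
  moreover have "(\<Sum>j\<in>UNIV. a j *\<^sub>R z j) - (\<Sum>j\<in>UNIV. b j *\<^sub>R z j) = (1 - c) *\<^sub>R (?A - ?B)"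
    using rest(3)[of a] rest(3)[of b] assms by (simp add: algebra_simps)
  ultimately show ?thesis using c by (simp add: scale mult_left_mono)
qed

definition mix :: "nat \<Rightarrow> ('m \<Rightarrow> 'a) \<Rightarrow> 'm \<Rightarrow> 'a" where
  "mix t z i = (\<Sum>j\<in>UNIV. W t $ i $ j *\<^sub>R z j)"

lemma mix_near: "t \<ge> 1 \<Longrightarrow> N (mix t z i - z k) \<le> spread N z"
proof -
  assume t: "t \<ge> 1"
  have "mix t z i - z k = (\<Sum>j\<in>UNIV. W t $ i $ j *\<^sub>R (z j - z k))"
    using row_sum[OF t] by (simp add: mix_def scaleR_diff_right sum_subtractf flip: scaleR_sum_left)
  also have "N \<dots> \<le> spread N z"
    by (rule convex_comb_le) (use t row_sum weight_nonneg spread_upper in auto)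
  finally show ?thesis .
qed

text \<open>
  Mixing is an average and hence non-expansive, so the errors \<open>e\<close> of the single steps add up
  to the distance from the noiseless evolution.
\<close>

lemma transition_drift:
  assumes t: "t \<ge> 1" and step: "\<And>s i. s < n \<Longrightarrow> N (x (Suc (t + s)) i - mix (t + s) (x (t + s)) i) \<le> e (t + s)"
    and "s \<le> n"
  shows "N (x (t + s) i - (\<Sum>j\<in>UNIV. transition W t s $ i $ j *\<^sub>R x t j)) \<le> (\<Sum>r<s. e (t + r))"
  using \<open>s \<le> n\<close>
proof (induction s arbitrary: i)
  case 0
  have "(\<Sum>j\<in>UNIV. transition W t 0 $ i $ j *\<^sub>R x t j) = x t i"
    by (simp add: mat_def if_distrib[of "\<lambda>c. c *\<^sub>R _"] cong: if_cong)
  then show ?case by simp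
next
  case (Suc s)
  let ?z = "\<lambda>s i. \<Sum>j\<in>UNIV. transition W t s $ i $ j *\<^sub>R x t j"
  have z: "?z (Suc s) i = mix (t + s) (?z s) i"
    by (simp add: mix_def matrix_matrix_mult_def scaleR_sum_left scaleR_sum_right) (rule sum.swap)
  have "mix (t + s) (x (t + s)) i - mix (t + s) (?z s) i
      = (\<Sum>j\<in>UNIV. W (t + s) $ i $ j *\<^sub>R (x (t + s) j - ?z s j))"
    by (simp add: mix_def scaleR_diff_right sum_subtractf)
  also have "N \<dots> \<le> (\<Sum>r<s. e (t + r))"
    by (rule convex_comb_le) (use Suc t weight_nonneg row_sum in auto)
  finally have "N (mix (t + s) (x (t + s)) i - ?z (Suc s) i) \<le> (\<Sum>r<s. e (t + r))"
    by (simp only: z)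
  then show ?case
    using triangle_diff[of "x (t + Suc s) i" "?z (Suc s) i" "mix (t + s) (x (t + s)) i"]
      step[of s i] Suc.prems by simp
qed

lemma spread_contraction:
  assumes t: "t = k * B + 1"
    and step: "\<And>s i. s < (CARD('m) * B) \<Longrightarrow> N (x (Suc (t + s)) i - mix (t + s) (x (t + s)) i) \<le> e (t + s)"
  shows "spread N (x (t + (CARD('m) * B))) \<le> (1 - \<eta> ^ (CARD('m) * B)) * spread N (x t) + 2 * (\<Sum>r<(CARD('m) * B). e (t + r))"
proof (rule spread_least)
  fix i j
  have t1: "t \<ge> 1" using t by simp
  let ?z = "\<lambda>i. \<Sum>j\<in>UNIV. transition W t (CARD('m) * B) $ i $ j *\<^sub>R x t j"
  have close: "N (x (t + (CARD('m) * B)) i - ?z i) \<le> (\<Sum>r<(CARD('m) * B). e (t + r))" for i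
    by (rule transition_drift[OF t1 step]) auto
  moreover have "N (?z i - ?z j) \<le> (1 - \<eta> ^ (CARD('m) * B)) * spread N (x t)"
  proof (rule averages_close)
    have "0 < (CARD('m) * B)" using B_pos by simp
    then show "\<eta> ^ (CARD('m) * B) < 1" using eta by (simp add: power_less_one_iff)
    show "\<eta> ^ (CARD('m) * B) \<le> transition W t (CARD('m) * B) $ i $ i" "\<eta> ^ (CARD('m) * B) \<le> transition W t (CARD('m) * B) $ j $ i"
      unfolding t by (rule transition_period_lower_bound)+
  qed (use eta t1 transition_nonneg transition_row_sum in auto)
  ultimately show "N (x (t + CARD('m) * B) i - x (t + CARD('m) * B) j)
      \<le> (1 - \<eta> ^ (CARD('m) * B)) * spread N (x t) + 2 * (\<Sum>r<CARD('m) * B. e (t + r))"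
    by (intro order_trans[OF quadrangle[of _ _ "?z i" "?z j"]])
      (use close[of i] close[of j] in linarith)
qed

lemma spread_growth:
  assumes t: "t \<ge> 1"
    and step: "\<And>s i. s < n \<Longrightarrow> N (x (Suc (t + s)) i - mix (t + s) (x (t + s)) i) \<le> e (t + s)"
  shows "spread N (x (t + n)) \<le> spread N (x t) + 2 * (\<Sum>r<n. e (t + r))"
proof (rule spread_least)
  fix i j
  let ?z = "\<lambda>i. \<Sum>j\<in>UNIV. transition W t n $ i $ j *\<^sub>R x t j"
  have close: "N (x (t + n) i - ?z i) \<le> (\<Sum>r<n. e (t + r))" for i
    by (rule transition_drift[OF t step]) auto
  moreover have "N (?z i - ?z j) \<le> (1 - 0) * spread N (x t)"
    by (rule averages_close) (use t transition_nonneg transition_row_sum in auto)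
  then have "N (?z i - ?z j) \<le> spread N (x t)" by simp
  ultimately show "N (x (t + n) i - x (t + n) j) \<le> spread N (x t) + 2 * (\<Sum>r<n. e (t + r))"
    by (intro order_trans[OF quadrangle[of _ _ "?z i" "?z j"]])
      (use close[of i] close[of j] in linarith)
qed

text \<open>
  Time is cut into blocks of \<open>H\<close> steps aligned with the connectivity windows.  At the block starts
  the spread contracts by the factor \<open>1 - \<epsilon>\<close> and grows by at most \<open>2 H q\<close> times the current
  stepsize.  Multiplied by the decreasing stepsize, this recursion telescopes and bounds the sum over the
  block starts; inside a block the weighted spread exceeds its value at the start by no more than another multiple
  of the squared stepsize.  Since the step bound is only assumed up to time \<open>n\<close>, the summand is cut off
  there.
\<close>

lemma weighted_spread_sum:
  fixes x :: "nat \<Rightarrow> 'm \<Rightarrow> 'a" and \<alpha> :: "nat \<Rightarrow> real"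
  defines "H \<equiv> CARD('m) * B"
  assumes pos: "\<And>t. t \<ge> 1 \<Longrightarrow> \<alpha> t > 0"
    and antimono: "\<And>s t. 1 \<le> s \<Longrightarrow> s \<le> t \<Longrightarrow> \<alpha> t \<le> \<alpha> s"
    and q: "q \<ge> 0"
    and step: "\<And>t i. 1 \<le> t \<Longrightarrow> t \<le> n \<Longrightarrow> N (x (Suc t) i - mix t (x t) i) \<le> \<alpha> t * q"
  shows "(\<Sum>t=1..n. \<alpha> t * spread N (x t))
    \<le> H / \<eta> ^ H * (\<alpha> 1 * spread N (x 1) + 4 * real H * q * (\<Sum>t=1..n. (\<alpha> t)\<^sup>2))"
proof (cases "n = 0")
  case True
  then show ?thesis using pos[of 1] spread_nonneg[of "x 1"] eta by simp
next
  case False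
  have H: "H \<ge> 1" using B_pos by (simp add: H_def Suc_leI)
  define a where "a k = \<alpha> (k * H + 1)" for k
  define u where "u k = spread N (x (k * H + 1))" for k
  define \<epsilon> where "\<epsilon> = \<eta> ^ H"
  \<comment> \<open>the index of the last block starting no later than time \<open>n\<close>\<close>
  define K where "K = (n - 1) div H"
  have \<epsilon>: "0 < \<epsilon>" "\<epsilon> \<le> 1" using eta by (auto simp: \<epsilon>_def power_le_one)
  have a: "a k > 0" for k using pos by (simp add: a_def)
  have u: "u k \<ge> 0" for k by (simp add: u_def spread_nonneg)
  have KH: "K * H + 1 \<le> n" unfolding K_def using False div_times_less_eq_dividend[of "n - 1" H] by linarith
  have block_le: "(\<Sum>r<s. \<alpha> (k * H + 1 + r) * q) \<le> H * q * a k" if "s \<le> H" for k s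
  proof -
    have "(\<Sum>r<s. \<alpha> (k * H + 1 + r) * q) \<le> (\<Sum>r<s. a k * q)"
      using q antimono by (intro sum_mono mult_right_mono) (auto simp: a_def)
    also have "\<dots> \<le> H * (a k * q)" using that a[of k] q by (auto intro!: mult_right_mono)
    finally show ?thesis by (simp add: algebra_simps)
  qed
  have contract: "a (Suc k) * u (Suc k) \<le> (1 - \<epsilon>) * (a k * u k) + 2 * real H * q * (a k)\<^sup>2"
    if "k < K" for k
  proof -
    have "(k + 1) * H \<le> K * H" using that by (intro mult_right_mono) auto
    then have kH: "k * H + H < n" using KH by simp
    have "u (Suc k) \<le> (1 - \<epsilon>) * u k + 2 * (\<Sum>r<H. \<alpha> (k * H + 1 + r) * q)"
      using spread_contraction[of "k * H + 1" "k * CARD('m)" x "\<lambda>t. \<alpha> t * q"] step kH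
      by (simp add: u_def \<epsilon>_def H_def algebra_simps)
    also have "\<dots> \<le> (1 - \<epsilon>) * u k + 2 * (H * q * a k)" using block_le[of H k] by simp
    finally have "a (Suc k) * u (Suc k) \<le> a (Suc k) * ((1 - \<epsilon>) * u k + 2 * (H * q * a k))"
      using a by (simp add: mult_left_mono)
    also have "\<dots> \<le> a k * ((1 - \<epsilon>) * u k + 2 * (H * q * a k))"
    proof (rule mult_right_mono)
      show "a (Suc k) \<le> a k" unfolding a_def by (rule antimono) auto
      show "0 \<le> (1 - \<epsilon>) * u k + 2 * (H * q * a k)"
        using \<epsilon> u[of k] a[of k] q by (intro add_nonneg_nonneg mult_nonneg_nonneg) auto
    qed
    finally show ?thesis by (simp add: algebra_simps power2_eq_square)
  qed
  have "\<epsilon> * (\<Sum>k<j. a k * u k) + a j * u j \<le> a 0 * u 0 + 2 * real H * q * (\<Sum>k<j. (a k)\<^sup>2)" if "j \<le> K" for j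
    using that
  proof (induction j)
    case (Suc j)
    then show ?case using contract[of j] by (simp add: algebra_simps)
  qed simp
  from this[of K] have "\<epsilon> * (\<Sum>k<K. a k * u k) + a K * u K \<le> a 0 * u 0 + 2 * real H * q * (\<Sum>k<K. (a k)\<^sup>2)"
    by simp
  moreover have "\<epsilon> * (a K * u K) \<le> a K * u K" using \<epsilon> a[of K] u[of K] by (intro mult_left_le_one_le) auto
  moreover have "0 \<le> 2 * real H * q * (a K)\<^sup>2" using q by simp
  ultimately have starts: "\<epsilon> * (\<Sum>k<Suc K. a k * u k) \<le> a 0 * u 0 + 2 * real H * q * (\<Sum>k<Suc K. (a k)\<^sup>2)"
    unfolding sum.lessThan_Suc distrib_left by linarith
  \<comment> \<open>time is shifted to start at 0, so that block \<open>k\<close> is \<open>{k * H..<k * H + H}\<close>\<close>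
  define h where "h t = (if t < n then \<alpha> (Suc t) * spread N (x (Suc t)) else 0)" for t
  have h: "h t \<le> a k * u k + 2 * real H * q * (a k)\<^sup>2" if t: "t \<in> {k * H..<k * H + H}" for k t
  proof (cases "t < n")
    case True
    define r where "r = t - k * H"
    have r: "Suc t = k * H + 1 + r" "r < H" using t by (auto simp: r_def)
    have "spread N (x (k * H + 1 + r)) \<le> u k + 2 * (\<Sum>s<r. \<alpha> (k * H + 1 + s) * q)"
      unfolding u_def by (rule spread_growth) (use True r step in auto)
    also have "\<dots> \<le> u k + 2 * (H * q * a k)" using block_le[of r k] r by simp
    finally have "h t \<le> \<alpha> (Suc t) * (u k + 2 * (H * q * a k))"
      using True pos by (simp add: h_def r mult_left_mono less_imp_le)
    also have "\<dots> \<le> a k * (u k + 2 * (H * q * a k))"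
      using antimono[of "k * H + 1" "Suc t"] t u[of k] q a[of k]
      by (intro mult_right_mono) (auto simp: a_def[of k] less_imp_le)
    finally show ?thesis by (simp add: algebra_simps power2_eq_square)
  next
    case False
    then show ?thesis using a[of k] u[of k] q by (simp add: h_def)
  qed
  have "(\<Sum>t=1..n. \<alpha> t * spread N (x t)) = (\<Sum>t<n. h t)"
    unfolding h_def by (rule sum.reindex_bij_witness[of _ Suc "\<lambda>t. t - 1"]) auto
  also have "\<dots> = (\<Sum>t<Suc K * H. h t)"
  proof (rule sum.mono_neutral_left)
    have "n - 1 < Suc K * H" using H by (simp add: K_def dividend_less_div_times)
    then show "{..<n} \<subseteq> {..<Suc K * H}" by auto
  qed (auto simp: h_def)
  also have "\<dots> = (\<Sum>k<Suc K. \<Sum>t = k * H..<k * H + H. h t)" by (rule sum.nat_group[symmetric])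
  also have "\<dots> \<le> (\<Sum>k<Suc K. H * (a k * u k + 2 * real H * q * (a k)\<^sup>2))"
  proof (rule sum_mono)
    fix k
    have "(\<Sum>t = k * H..<k * H + H. h t) \<le> (\<Sum>t = k * H..<k * H + H. a k * u k + 2 * real H * q * (a k)\<^sup>2)"
      by (intro sum_mono h)
    then show "(\<Sum>t = k * H..<k * H + H. h t) \<le> H * (a k * u k + 2 * real H * q * (a k)\<^sup>2)" by simp
  qed
  also have "\<dots> = H * ((\<Sum>k<Suc K. a k * u k) + 2 * real H * q * (\<Sum>k<Suc K. (a k)\<^sup>2))"
    by (simp add: sum_distrib_left sum.distrib distrib_left del: sum.lessThan_Suc)
  also have "\<dots> \<le> H * ((a 0 * u 0 + 4 * real H * q * (\<Sum>k<Suc K. (a k)\<^sup>2)) / \<epsilon>)"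
  proof (intro mult_left_mono)
    let ?S = "2 * real H * q * (\<Sum>k<Suc K. (a k)\<^sup>2)"
    have "?S \<ge> 0" using q by (intro mult_nonneg_nonneg sum_nonneg) auto
    then have "\<epsilon> * ?S \<le> ?S" using \<epsilon> by (simp add: mult_left_le_one_le)
    then have "\<epsilon> * ((\<Sum>k<Suc K. a k * u k) + ?S) \<le> a 0 * u 0 + 2 * ?S"
      using starts unfolding distrib_left by linarith
    then have "((\<Sum>k<Suc K. a k * u k) + ?S) * \<epsilon> \<le> a 0 * u 0 + 4 * real H * q * (\<Sum>k<Suc K. (a k)\<^sup>2)"
      by (simp only: mult.commute[of _ \<epsilon>])
    then show "(\<Sum>k<Suc K. a k * u k) + ?S \<le> (a 0 * u 0 + 4 * real H * q * (\<Sum>k<Suc K. (a k)\<^sup>2)) / \<epsilon>"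
      by (simp only: pos_le_divide_eq[OF \<epsilon>(1)])
  qed simp
  also have "\<dots> \<le> H * ((a 0 * u 0 + 4 * real H * q * (\<Sum>t=1..n. (\<alpha> t)\<^sup>2)) / \<epsilon>)"
  proof -
    have "(\<Sum>k<Suc K. (a k)\<^sup>2) = (\<Sum>t\<in>(\<lambda>k. k * H + 1) ` {..<Suc K}. (\<alpha> t)\<^sup>2)"
      using H by (subst sum.reindex) (auto simp: a_def inj_on_def)
    also have "\<dots> \<le> (\<Sum>t=1..n. (\<alpha> t)\<^sup>2)"
    proof (rule sum_mono2)
      have "k * H + 1 \<le> n" if "k < Suc K" for k
      proof -
        have "k * H \<le> K * H" using that by (intro mult_right_mono) auto
        then show ?thesis using KH by linarith
      qed
      then show "(\<lambda>k. k * H + 1) ` {..<Suc K} \<subseteq> {1..n}" by auto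
    qed auto
    finally show ?thesis using q \<epsilon>
      by (intro mult_left_mono divide_right_mono add_left_mono) auto
  qed
  finally show ?thesis by (simp add: a_def u_def \<epsilon>_def)
qed

end

section \<open>One run of the algorithm\<close>

text \<open>
  The data that do not depend on chance, with arbitrary positive decreasing stepsizes.
\<close>

locale composite_problem = normed_network W B \<eta> N
  for W :: "nat \<Rightarrow> real ^ 'm ^ 'm::finite" and B \<eta>
    and N :: "'a::euclidean_space \<Rightarrow> real" +
  fixes X D :: "'a set" and f \<psi> :: "'m \<Rightarrow> 'a \<Rightarrow> real" and F :: "'a \<Rightarrow> real"
    and \<Phi> :: "'a \<Rightarrow> real" and G\<Phi> :: "'a \<Rightarrow> 'a" and \<alpha> :: "nat \<Rightarrow> real"
    and x1 :: "'m \<Rightarrow> 'a" and xs :: 'a and \<sigma> G G\<psi> :: real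
  assumes X: "convex X" "X \<subseteq> D" and f: "\<And>i. convex_on D (f i)"
    and F: "\<And>z. F z = (\<Sum>i\<in>UNIV. f i z) + (\<Sum>i\<in>UNIV. \<psi> i z)"
    and xs: "xs \<in> X" "\<And>z. z \<in> X \<Longrightarrow> F xs \<le> F z"
    and x1: "\<And>i. x1 i \<in> X"
    and boundedness: "boundedness_assumption X D N f \<psi> G G\<psi>"
    and Bregman: "bregman_assumption TYPE('m) X N \<sigma> \<Phi> G\<Phi>"
    and step_pos: "\<And>t. t \<ge> 1 \<Longrightarrow> \<alpha> t > 0"
    and step_antimono: "\<And>s t. 1 \<le> s \<Longrightarrow> s \<le> t \<Longrightarrow> \<alpha> t \<le> \<alpha> s"
begin

lemma G_pos: "G > 0" and G\<psi>_pos: "G\<psi> > 0" and \<psi>: "convex_on X (\<psi> i)"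
  and \<psi>_Lipschitz: "x \<in> X \<Longrightarrow> y \<in> X \<Longrightarrow> \<bar>\<psi> i x - \<psi> i y\<bar> \<le> G\<psi> * N (x - y)"
  and subgradient_le: "x \<in> X \<Longrightarrow> v \<in> subdifferential D (f i) x \<Longrightarrow> dual_norm N v \<le> G"
  using boundedness unfolding boundedness_assumption_def by auto

lemma \<sigma>_pos: "\<sigma> > 0" and grad: "gradient_on X \<Phi> G\<Phi>" and strongly_convex: "strongly_convex_on X N \<sigma> \<Phi>"
  and bregman_mix: "x \<in> X \<Longrightarrow> (\<And>j. y j \<in> X) \<Longrightarrow> (\<And>j. 0 \<le> a j) \<Longrightarrow> (\<Sum>j\<in>UNIV. a j) = 1 \<Longrightarrow>
        bregman \<Phi> G\<Phi> x (\<Sum>j\<in>UNIV. a j *\<^sub>R y j) \<le> (\<Sum>j\<in>UNIV. a j * bregman \<Phi> G\<Phi> x (y j))"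
  for a :: "'m \<Rightarrow> real"
  using Bregman unfolding bregman_assumption_def by auto

lemmas bregman_lower = bregman_lower_bound[OF grad strongly_convex]

definition potential :: "('m \<Rightarrow> 'a) \<Rightarrow> real" where
  "potential z = (\<Sum>i\<in>UNIV. bregman \<Phi> G\<Phi> xs (z i))"

lemma potential_lower:
  assumes "\<And>i. z i \<in> X"
  shows "\<sigma> / 2 * (N (z i - xs))\<^sup>2 \<le> potential z"
proof -
  have "\<sigma> / 2 * (N (z i - xs))\<^sup>2 \<le> bregman \<Phi> G\<Phi> xs (z i)"
    using bregman_lower[OF xs(1) assms, of i] by (simp only: commute[of xs "z i"])
  also have "\<dots> \<le> potential z"
  proof -
    have "0 \<le> bregman \<Phi> G\<Phi> xs (z j)" for j
      by (rule order_trans[OF _ bregman_lower[OF xs(1) assms]]) (use \<sigma>_pos in simp)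
    then show ?thesis unfolding potential_def by (intro member_le_sum) auto
  qed
  finally show ?thesis .
qed

text \<open>
  The noise enters as an arbitrary fixed sequence: the energy estimates hold for every single outcome,
  and probability is only needed to bound the noise terms in them.
\<close>

definition run :: "(nat \<Rightarrow> 'm \<Rightarrow> 'a) \<Rightarrow> (nat \<Rightarrow> 'm \<Rightarrow> 'a) \<Rightarrow> (nat \<Rightarrow> 'm \<Rightarrow> 'a) \<Rightarrow> bool" where
  "run x g \<xi> \<longleftrightarrow> (\<forall>i. x 1 i = x1 i) \<and>
     (\<forall>t\<ge>1. \<forall>i. g t i \<in> subdifferential D (f i) (x t i) \<and>
        is_arg_min
          (\<lambda>z. (g t i - \<xi> t i) \<bullet> z + 1 / \<alpha> t * bregman \<Phi> G\<Phi> z (mix t (x t) i) + \<psi> i z)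
          (\<lambda>z. z \<in> X) (x (Suc t) i))"

context
  fixes x g \<xi> assumes run: "run x g \<xi>"
begin

lemma x_in_X: "t \<ge> 1 \<Longrightarrow> x t i \<in> X"
  using run x1 by (cases "t = 1"; cases t) (auto simp: run_def is_arg_min_def)

lemma y_in_X: "t \<ge> 1 \<Longrightarrow> mix t (x t) i \<in> X"
  unfolding mix_def
  by (intro convex_sum) (use X weight_nonneg row_sum x_in_X in auto)

lemma g_subgradient: "t \<ge> 1 \<Longrightarrow> g t i \<in> subdifferential D (f i) (x t i)"
  and x_min: "t \<ge> 1 \<Longrightarrow> is_arg_min
          (\<lambda>z. (g t i - \<xi> t i) \<bullet> z + 1 / \<alpha> t * bregman \<Phi> G\<Phi> z (mix t (x t) i) + \<psi> i z)
          (\<lambda>z. z \<in> X) (x (Suc t) i)"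
  using run by (auto simp: run_def)

lemma g_le: "t \<ge> 1 \<Longrightarrow> dual_norm N (g t i) \<le> G"
  using subgradient_le x_in_X g_subgradient by blast

lemma x_interior: 
  assumes "t \<ge> 1" shows "x t i \<in> interior D"
proof (rule bounded_subdifferential_imp_interior)
  show "convex D" using f by (auto simp: convex_on_def)
  show "g t i \<in> subdifferential D (f i) (x t i)" using g_subgradient[OF assms] .
  show "x t i \<in> D" using x_in_X[OF assms] X(2) by blast
  show "dual_norm N v \<le> G" if "v \<in> subdifferential D (f i) (x t i)" for v
    using subgradient_le x_in_X[OF assms] that by blast
qed

text \<open>
  The subgradient used here belongs to agent \<open>i\<close> at the iterate of another agent \<open>l\<close>; the algorithm does not
  provide it, but it exists because the iterates of all agents are interior points of \<open>D\<close>.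
\<close>

lemma f_Lipschitz:
  assumes "t \<ge> 1" "z \<in> X"
  shows "f i (x t l) - f i z \<le> G * N (x t l - z)"
proof -
  obtain v where "v \<in> subdifferential D (f i) (x t l)"
    using subgradient_exists_interior[OF f x_interior[OF assms(1)]] by blast
  then show ?thesis using subgradient_Lipschitz subgradient_le x_in_X assms X(2) by blast
qed

text \<open>
  Convexity of the divergence in its second argument uses that rows of \<open>W t\<close> sum to one; columns summing to one
  then give each agent total weight one.
\<close>

lemma potential_mix:
  assumes "t \<ge> 1"
  shows "(\<Sum>i\<in>UNIV. bregman \<Phi> G\<Phi> xs (mix t (x t) i)) \<le> potential (x t)"
proof -
  have "(\<Sum>i\<in>UNIV. bregman \<Phi> G\<Phi> xs (mix t (x t) i))
      \<le> (\<Sum>i\<in>UNIV. \<Sum>j\<in>UNIV. W t $ i $ j * bregman \<Phi> G\<Phi> xs (x t j))"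
    unfolding mix_def
    by (intro sum_mono bregman_mix xs x_in_X weight_nonneg row_sum assms)
  also have "\<dots> = (\<Sum>j\<in>UNIV. (\<Sum>i\<in>UNIV. W t $ i $ j) * bregman \<Phi> G\<Phi> xs (x t j))"
    by (subst sum.swap) (simp add: sum_distrib_right)
  finally show ?thesis using column_sum[OF assms] by (simp add: potential_def)
qed

lemma step_length:
  assumes t: "t \<ge> 1" and b: "dual_norm N (\<xi> t i) \<le> b"
  shows "N (x (Suc t) i - mix t (x t) i) \<le> \<alpha> t * ((G + G\<psi> + b) / \<sigma>)"
proof -
  have "\<sigma> * N (x (Suc t) i - mix t (x t) i) \<le> \<alpha> t * (dual_norm N (g t i - \<xi> t i) + G\<psi>)"
    by (rule mirror_step_length[OF grad strongly_convex \<sigma>_pos \<psi> \<psi>_Lipschitz _ step_pos[OF t]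
          y_in_X[OF t] x_min[OF t]])
       (use G\<psi>_pos in auto)
  also have "dual_norm N (g t i - \<xi> t i) \<le> G + b"
    using dual_triangle[of "g t i" "- \<xi> t i"] b g_le[OF t, of i] by (simp add: dual_minus)
  finally show ?thesis using \<sigma>_pos step_pos[OF t] by (simp add: field_simps)
qed

text \<open>
  The three-point inequality at \<open>xs\<close>, where \<open>?v \<bullet> (p - xs)\<close> is split at \<open>y\<close> and at \<open>x t i\<close>, the
  point to which the subgradient belongs.  Replacing \<open>f i\<close> and \<open>\<psi> i\<close> at the points of agent \<open>i\<close> by their values at the common point
  \<open>x t l\<close> costs the spread and the step length.
\<close>

lemma agent_step:
  assumes t: "t \<ge> 1" and b: "dual_norm N (\<xi> t i) \<le> b"
  defines "y \<equiv> mix t (x t) i" and "p \<equiv> x (Suc t) i" and "Q \<equiv> G + G\<psi> + b"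
  shows "bregman \<Phi> G\<Phi> xs p + \<alpha> t * (f i (x t l) - f i xs + (\<psi> i (x t l) - \<psi> i xs))
    \<le> bregman \<Phi> G\<Phi> xs y + \<alpha> t * (\<xi> t i \<bullet> (y - xs))
      + (2 * Q\<^sup>2 / \<sigma> * (\<alpha> t)\<^sup>2 + 2 * (G + G\<psi>) * (\<alpha> t * spread N (x t)))"
proof -
  let ?v = "g t i - \<xi> t i" and ?\<Delta> = "spread N (x t)"
  have b0: "b \<ge> 0" using b dual_nonneg order_trans by blast
  have Q: "Q \<ge> 0" "G\<psi> \<le> Q" using b0 G_pos G\<psi>_pos by (auto simp: Q_def)
  have gG: "dual_norm N (g t i) \<le> G" using g_le[OF t] .
  have pX: "p \<in> X" and yX: "y \<in> X" and xX: "\<And>j. x t j \<in> X"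
    using x_in_X[of "Suc t"] x_in_X[OF t] y_in_X[OF t] by (auto simp: p_def y_def)
  have len: "N (p - y) \<le> \<alpha> t * (Q / \<sigma>)"
    unfolding p_def y_def Q_def by (rule step_length[OF t b])
  have "0 \<le> bregman \<Phi> G\<Phi> p y"
    by (rule order_trans[OF _ bregman_lower[OF pX yX]]) (use \<sigma>_pos in simp)
  moreover have "\<alpha> t * (?v \<bullet> (p - xs) + (\<psi> i p - \<psi> i xs))
      \<le> bregman \<Phi> G\<Phi> xs y - bregman \<Phi> G\<Phi> xs p - bregman \<Phi> G\<Phi> p y"
    using mirror_step[OF grad X(1) \<psi> step_pos[OF t] y_in_X[OF t] xs(1) x_min[OF t], of i]
    by (simp add: y_def p_def)
  ultimately have main: "bregman \<Phi> G\<Phi> xs p + \<alpha> t * (?v \<bullet> (p - xs) + (\<psi> i p - \<psi> i xs))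
      \<le> bregman \<Phi> G\<Phi> xs y" by simp
  have step: "- (?v \<bullet> (p - y)) \<le> Q * (\<alpha> t * (Q / \<sigma>))"
  proof -
    have "dual_norm N ?v \<le> Q"
      using dual_triangle[of "g t i" "- \<xi> t i"] b gG G\<psi>_pos by (simp add: dual_minus Q_def)
    then have "dual_norm N ?v * N (p - y) \<le> Q * (\<alpha> t * (Q / \<sigma>))"
      using len Q by (intro mult_mono) auto
    then show ?thesis using dual_ineq'(2)[of ?v "p - y"] by linarith
  qed
  have grad_y: "- (g t i \<bullet> (y - x t i)) \<le> G * ?\<Delta>"
  proof -
    have "dual_norm N (g t i) * N (y - x t i) \<le> G * ?\<Delta>"
      unfolding y_def using gG mix_near[OF t] G_pos by (intro mult_mono) auto
    then show ?thesis using dual_ineq'(2)[of "g t i" "y - x t i"] by linarith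
  qed
  have f_xs: "f i (x t i) - f i xs \<le> g t i \<bullet> (x t i - xs)"
    using g_subgradient[OF t, of i] xs(1) X(2)
    by (force simp: subdifferential_def inner_diff_right)
  have f_l: "f i (x t l) - f i (x t i) \<le> G * ?\<Delta>"
    using f_Lipschitz[OF t xX[of i], of i l] spread_upper[of N "x t" l i] G_pos
    by (meson less_imp_le mult_left_mono order_trans)
  have \<psi>_l: "\<psi> i (x t l) - \<psi> i p \<le> G\<psi> * ?\<Delta> + Q * (\<alpha> t * (Q / \<sigma>))"
  proof -
    have "N (x t l - p) \<le> ?\<Delta> + \<alpha> t * (Q / \<sigma>)"
      using triangle_diff[of "x t l" p y] mix_near[OF t, of "x t" i l] len commute[of "x t l" y]
        commute[of y p] unfolding y_def by linarith
    then have "G\<psi> * N (x t l - p) \<le> G\<psi> * (?\<Delta> + \<alpha> t * (Q / \<sigma>))"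
      using G\<psi>_pos by (intro mult_left_mono) auto
    moreover have "G\<psi> * (\<alpha> t * (Q / \<sigma>)) \<le> Q * (\<alpha> t * (Q / \<sigma>))"
      using Q \<sigma>_pos step_pos[OF t] by (intro mult_right_mono) auto
    ultimately show ?thesis using \<psi>_Lipschitz[OF xX pX, of i l] by (simp add: distrib_left)
  qed
  have \<Delta>_coeff: "(2 * G + G\<psi>) * ?\<Delta> = 2 * (G * ?\<Delta>) + G\<psi> * ?\<Delta>"
    by (simp add: algebra_simps)
  have "f i (x t l) - f i xs + (\<psi> i (x t l) - \<psi> i xs)
      \<le> (?v \<bullet> (p - xs) + (\<psi> i p - \<psi> i xs)) + \<xi> t i \<bullet> (y - xs)
        + (2 * (Q * (\<alpha> t * (Q / \<sigma>))) + (2 * G + G\<psi>) * ?\<Delta>)" (is "?l \<le> ?r")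
  proof -
    define e where "e = Q * (\<alpha> t * (Q / \<sigma>))"
    show "?l \<le> ?r"
      using step grad_y f_xs f_l \<psi>_l
      unfolding \<Delta>_coeff e_def[symmetric] inner_diff_left inner_diff_right by linarith
  qed
  also have "\<dots> \<le> (?v \<bullet> (p - xs) + (\<psi> i p - \<psi> i xs)) + \<xi> t i \<bullet> (y - xs)
        + (2 * (Q * (\<alpha> t * (Q / \<sigma>))) + 2 * (G + G\<psi>) * ?\<Delta>)"
    using G\<psi>_pos spread_nonneg[of "x t"] by (simp add: algebra_simps)
  finally have "\<alpha> t * (f i (x t l) - f i xs + (\<psi> i (x t l) - \<psi> i xs)) \<le>
      \<alpha> t * ((?v \<bullet> (p - xs) + (\<psi> i p - \<psi> i xs)) + \<xi> t i \<bullet> (y - xs)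
        + (2 * (Q * (\<alpha> t * (Q / \<sigma>))) + 2 * (G + G\<psi>) * ?\<Delta>))"
    using step_pos[OF t] by (simp add: mult_left_mono)
  also have "\<dots> = \<alpha> t * (?v \<bullet> (p - xs) + (\<psi> i p - \<psi> i xs)) + \<alpha> t * (\<xi> t i \<bullet> (y - xs))
        + (2 * Q\<^sup>2 / \<sigma> * (\<alpha> t)\<^sup>2 + 2 * (G + G\<psi>) * (\<alpha> t * ?\<Delta>))"
    by (simp add: algebra_simps power2_eq_square)
  finally show ?thesis using main by linarith
qed

lemma network_step:
  assumes t: "t \<ge> 1" and b: "\<And>i. dual_norm N (\<xi> t i) \<le> b"
  defines "Q \<equiv> G + G\<psi> + b"
  shows "potential (x (Suc t)) + \<alpha> t * (F (x t l) - F xs)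
    \<le> potential (x t) + (\<Sum>i\<in>UNIV. \<alpha> t * (\<xi> t i \<bullet> (mix t (x t) i - xs)))
      + CARD('m) * (2 * Q\<^sup>2 / \<sigma> * (\<alpha> t)\<^sup>2 + 2 * (G + G\<psi>) * (\<alpha> t * spread N (x t)))"
proof -
  have "potential (x (Suc t)) + \<alpha> t * (F (x t l) - F xs)
      = (\<Sum>i\<in>UNIV. bregman \<Phi> G\<Phi> xs (x (Suc t) i)
          + \<alpha> t * (f i (x t l) - f i xs + (\<psi> i (x t l) - \<psi> i xs)))"
    by (simp add: potential_def F sum.distrib sum_subtractf algebra_simps sum_distrib_left)
  also have "\<dots> \<le> (\<Sum>i\<in>UNIV. bregman \<Phi> G\<Phi> xs (mix t (x t) i)
        + \<alpha> t * (\<xi> t i \<bullet> (mix t (x t) i - xs))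
      + (2 * Q\<^sup>2 / \<sigma> * (\<alpha> t)\<^sup>2 + 2 * (G + G\<psi>) * (\<alpha> t * spread N (x t))))"
    unfolding Q_def by (intro sum_mono agent_step[OF t b])
  also have "\<dots> \<le> potential (x t) + (\<Sum>i\<in>UNIV. \<alpha> t * (\<xi> t i \<bullet> (mix t (x t) i - xs)))
      + CARD('m) * (2 * Q\<^sup>2 / \<sigma> * (\<alpha> t)\<^sup>2 + 2 * (G + G\<psi>) * (\<alpha> t * spread N (x t)))"
    using potential_mix[OF t] by (simp add: sum.distrib)
  finally show ?thesis .
qed

lemma telescoped:
  assumes b: "\<And>t i. 1 \<le> t \<Longrightarrow> t \<le> n \<Longrightarrow> dual_norm N (\<xi> t i) \<le> b"
  defines "Q \<equiv> G + G\<psi> + b"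
  shows "potential (x (Suc n)) + (\<Sum>t=1..n. \<alpha> t * (F (x t l) - F xs))
    \<le> potential x1 + (\<Sum>i\<in>UNIV. \<Sum>t=1..n. \<alpha> t * (\<xi> t i \<bullet> (mix t (x t) i - xs)))
      + CARD('m) * (2 * Q\<^sup>2 / \<sigma> * (\<Sum>t=1..n. (\<alpha> t)\<^sup>2)
          + 2 * (G + G\<psi>) * (\<Sum>t=1..n. \<alpha> t * spread N (x t)))"
  using b
proof (induction n)
  case 0
  have "x (Suc 0) = x1" using run by (auto simp: run_def)
  then show ?case by simp
next
  case (Suc n)
  have "potential (x (Suc n)) + (\<Sum>t=1..n. \<alpha> t * (F (x t l) - F xs))
    \<le> potential x1 + (\<Sum>i\<in>UNIV. \<Sum>t=1..n. \<alpha> t * (\<xi> t i \<bullet> (mix t (x t) i - xs)))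
      + CARD('m) * (2 * Q\<^sup>2 / \<sigma> * (\<Sum>t=1..n. (\<alpha> t)\<^sup>2)
          + 2 * (G + G\<psi>) * (\<Sum>t=1..n. \<alpha> t * spread N (x t)))"
    using Suc by auto
  with network_step[of "Suc n" b l] Suc.prems show ?case
    unfolding Q_def by (simp add: sum.distrib distrib_left)
qed

end

text \<open>
  The three constants below are the ones that arise when \<open>weighted_spread_sum\<close> is inserted into
  \<open>telescoped\<close>.  They depend on the data of the problem alone, neither on the horizon nor on the noise.
\<close>

definition spread_factor :: real where
  "spread_factor = real (CARD('m) * B) / \<eta> ^ (CARD('m) * B)"

definition initial_energy :: real where
  "initial_energy = potential x1 + 2 * CARD('m) * (G + G\<psi>) * spread_factor * \<alpha> 1 * spread N x1"

definition energy_rate :: real where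
  "energy_rate = CARD('m) * (2 + 8 * spread_factor * (CARD('m) * B)) / \<sigma>"

lemma spread_factor_nonneg: "spread_factor \<ge> 0"
  using eta by (simp add: spread_factor_def)

lemma energy_rate_nonneg: "energy_rate \<ge> 0"
  using spread_factor_nonneg \<sigma>_pos by (simp add: energy_rate_def)

lemma initial_energy_nonneg: "initial_energy \<ge> 0"
proof -
  have "0 \<le> potential x1"
    by (rule order_trans[OF _ potential_lower[of x1 undefined]]) (use \<sigma>_pos x1 in auto)
  then show ?thesis
    using spread_factor_nonneg G_pos G\<psi>_pos step_pos[of 1] spread_nonneg[of x1]
    by (simp add: initial_energy_def)
qed

lemma energy_bound:
  assumes run: "run x g \<xi>" and b: "\<And>t i. 1 \<le> t \<Longrightarrow> t \<le> n \<Longrightarrow> dual_norm N (\<xi> t i) \<le> b" and b0: "b \<ge> 0"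
  shows "potential (x (Suc n)) + (\<Sum>t=1..n. \<alpha> t * (F (x t l) - F xs))
    \<le> initial_energy + energy_rate * (G + G\<psi> + b)\<^sup>2 * (\<Sum>t=1..n. (\<alpha> t)\<^sup>2)
      + (\<Sum>i\<in>UNIV. \<Sum>t=1..n. \<alpha> t * (\<xi> t i \<bullet> (mix t (x t) i - xs)))"
proof -
  define Q where "Q = G + G\<psi> + b"
  define S where "S = (\<Sum>t=1..n. (\<alpha> t)\<^sup>2)"
  define H where "H = real (CARD('m) * B)"
  let ?m = "real CARD('m)"
  have Q: "0 \<le> Q" "G + G\<psi> \<le> Q" using G_pos G\<psi>_pos b0 by (auto simp: Q_def)
  have x1_eq: "x 1 = x1" using run by (auto simp: run_def)
  have "(\<Sum>t=1..n. \<alpha> t * spread N (x t)) \<le> spread_factor * (\<alpha> 1 * spread N x1 + 4 * H * (Q / \<sigma>) * S)"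
    using weighted_spread_sum[where \<alpha> = \<alpha> and q = "Q / \<sigma>" and n = n and x = x, OF step_pos step_antimono]
      step_length[OF run, of _ _ b] b Q(1) \<sigma>_pos
    unfolding spread_factor_def H_def S_def Q_def x1_eq[symmetric] by simp
  then have "2 * (G + G\<psi>) * (\<Sum>t=1..n. \<alpha> t * spread N (x t))
      \<le> 2 * (G + G\<psi>) * (spread_factor * (\<alpha> 1 * spread N x1 + 4 * H * (Q / \<sigma>) * S))"
    using G_pos G\<psi>_pos by (intro mult_left_mono) auto
  also have "\<dots> = 2 * (G + G\<psi>) * spread_factor * \<alpha> 1 * spread N x1
        + (G + G\<psi>) * (8 * spread_factor * H * (Q / \<sigma>) * S)"
    by (simp add: algebra_simps)
  also have "\<dots> \<le> 2 * (G + G\<psi>) * spread_factor * \<alpha> 1 * spread N x1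
        + Q * (8 * spread_factor * H * (Q / \<sigma>) * S)"
  proof (intro add_left_mono mult_right_mono Q(2))
    have "0 \<le> S" "0 \<le> H" "0 \<le> Q / \<sigma>" using Q \<sigma>_pos by (auto simp: S_def H_def intro: sum_nonneg)
    then show "0 \<le> 8 * spread_factor * H * (Q / \<sigma>) * S"
      using spread_factor_nonneg by (intro mult_nonneg_nonneg) auto
  qed
  finally have "2 * Q\<^sup>2 / \<sigma> * S + 2 * (G + G\<psi>) * (\<Sum>t=1..n. \<alpha> t * spread N (x t))
      \<le> 2 * Q\<^sup>2 / \<sigma> * S + (2 * (G + G\<psi>) * spread_factor * \<alpha> 1 * spread N x1
        + Q * (8 * spread_factor * H * (Q / \<sigma>) * S))" by simp
  then have "?m * (2 * Q\<^sup>2 / \<sigma> * S + 2 * (G + G\<psi>) * (\<Sum>t=1..n. \<alpha> t * spread N (x t)))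
      \<le> ?m * (2 * Q\<^sup>2 / \<sigma> * S + (2 * (G + G\<psi>) * spread_factor * \<alpha> 1 * spread N x1
        + Q * (8 * spread_factor * H * (Q / \<sigma>) * S)))"
    by (intro mult_left_mono) auto
  also have "\<dots> = (initial_energy - potential x1) + energy_rate * Q\<^sup>2 * S"
    using \<sigma>_pos by (simp add: initial_energy_def energy_rate_def H_def field_simps power2_eq_square)
  finally show ?thesis
    using telescoped[OF run b, of n l] unfolding Q_def S_def by linarith
qed

text \<open>
  The direction in which the noise is tested, switched off beyond distance \<open>R\<close>.  It depends on the
  current mixed state only, so along a run it is predictable and bounded.
\<close>

definition stopped_direction :: "real \<Rightarrow> nat \<Rightarrow> 'a \<Rightarrow> 'a" where
  "stopped_direction R t y = (if N (y - xs) \<le> R then \<alpha> t *\<^sub>R (y - xs) else 0)"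

text \<open>
  As long as all earlier mixed states are within distance \<open>R\<close>, the stopped noise terms are
  the true ones and the energy is at most \<open>\<sigma> / 2 * R\<^sup>2\<close>.  Strong convexity then puts the next
  iterates, and so their averages, within distance \<open>R\<close>; minimality of \<open>xs\<close> is what allows dropping the
  gaps from the energy inequality in this induction.
\<close>

lemma bootstrap:
  fixes K :: real
  assumes run: "run x g \<xi>" and b: "\<And>t i. 1 \<le> t \<Longrightarrow> t \<le> T \<Longrightarrow> dual_norm N (\<xi> t i) \<le> b" and b0: "b \<ge> 0"
    and noise: "\<And>n i. n \<le> T \<Longrightarrow> (\<Sum>t=1..n. stopped_direction R t (mix t (x t) i) \<bullet> \<xi> t i) \<le> K"
    and R: "R \<ge> 0" "initial_energy + energy_rate * (G + G\<psi> + b)\<^sup>2 * (\<Sum>t=1..T. (\<alpha> t)\<^sup>2) + CARD('m) * K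
        \<le> \<sigma> / 2 * R\<^sup>2"
  shows "(\<Sum>t=1..T. \<alpha> t * (F (x t l) - F xs)) \<le> \<sigma> / 2 * R\<^sup>2"
proof -
  have main: "potential (x (Suc n)) + (\<Sum>t=1..n. \<alpha> t * (F (x t l) - F xs)) \<le> \<sigma> / 2 * R\<^sup>2"
    if near: "\<And>t i. 1 \<le> t \<Longrightarrow> t \<le> n \<Longrightarrow> N (mix t (x t) i - xs) \<le> R" and n: "n \<le> T" for n
  proof -
    have "(\<Sum>i\<in>UNIV. \<Sum>t=1..n. \<alpha> t * (\<xi> t i \<bullet> (mix t (x t) i - xs)))
        = (\<Sum>i\<in>UNIV. \<Sum>t=1..n. stopped_direction R t (mix t (x t) i) \<bullet> \<xi> t i)"
      by (intro sum.cong refl) (simp add: stopped_direction_def near inner_commute)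
    also have "\<dots> \<le> (\<Sum>i\<in>(UNIV :: 'm set). K)" by (intro sum_mono noise n)
    finally have "(\<Sum>i\<in>UNIV. \<Sum>t=1..n. \<alpha> t * (\<xi> t i \<bullet> (mix t (x t) i - xs))) \<le> CARD('m) * K" by simp
    moreover have "energy_rate * (G + G\<psi> + b)\<^sup>2 * (\<Sum>t=1..n. (\<alpha> t)\<^sup>2)
        \<le> energy_rate * (G + G\<psi> + b)\<^sup>2 * (\<Sum>t=1..T. (\<alpha> t)\<^sup>2)"
      using n energy_rate_nonneg by (intro mult_left_mono sum_mono2) auto
    ultimately show ?thesis using energy_bound[OF run, of n b l] b b0 n R(2) by fastforce
  qed
  have gap: "0 \<le> (\<Sum>t=1..n. \<alpha> t * (F (x t l) - F xs))" for n
    using xs(2) x_in_X[OF run] step_pos by (intro sum_nonneg mult_nonneg_nonneg) (auto simp: less_imp_le)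
  have near: "N (mix t (x t) i - xs) \<le> R" if "1 \<le> t" "t \<le> Suc T" for t i
    using that
  proof (induction t arbitrary: i rule: less_induct)
    case (less t)
    then obtain n where n: "t = Suc n" by (cases t) auto
    have "potential (x t) \<le> \<sigma> / 2 * R\<^sup>2"
      using main[of n] gap[of n] less n by auto
    then have "\<sigma> / 2 * (N (x t j - xs))\<^sup>2 \<le> \<sigma> / 2 * R\<^sup>2" for j
      using potential_lower[of "x t" j, OF x_in_X[OF run less.prems(1)]] by linarith
    then have near_j: "N (x t j - xs) \<le> R" for j
      using \<sigma>_pos R(1) power2_le_imp_le[of "N (x t j - xs)" R] by simp
    have "mix t (x t) i - xs = (\<Sum>j\<in>UNIV. W t $ i $ j *\<^sub>R (x t j - xs))"
      using row_sum[OF less.prems(1)]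
      by (simp add: mix_def scaleR_diff_right sum_subtractf flip: scaleR_sum_left)
    also have "N \<dots> \<le> R"
      by (rule convex_comb_le) (use less.prems(1) row_sum weight_nonneg near_j in auto)
    finally show ?case .
  qed
  have "0 \<le> potential (x (Suc T))"
    by (rule order_trans[OF _ potential_lower[of _ undefined]]) (use \<sigma>_pos x_in_X[OF run] in auto)
  then show ?thesis using main[of T] near by fastforce
qed

lemma convex_objective: "convex_on X F"
proof -
  have "convex_on X (f i)" for i by (rule convex_on_subset[OF f X(2) X(1)])
  then have "F (u *\<^sub>R y + v *\<^sub>R z) \<le> u * F y + v * F z"
    if "y \<in> X" "z \<in> X" "0 \<le> u" "0 \<le> v" "u + v = 1" for y z u v
  proof -
    have "(\<Sum>i\<in>UNIV. f i (u *\<^sub>R y + v *\<^sub>R z)) \<le> (\<Sum>i\<in>UNIV. u * f i y + v * f i z)"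
      "(\<Sum>i\<in>UNIV. \<psi> i (u *\<^sub>R y + v *\<^sub>R z)) \<le> (\<Sum>i\<in>UNIV. u * \<psi> i y + v * \<psi> i z)"
      using that \<open>\<And>i. convex_on X (f i)\<close> \<psi> by (auto intro!: sum_mono simp: convex_on_def)
    then show ?thesis unfolding F by (simp add: sum.distrib sum_distrib_left algebra_simps)
  qed
  then show ?thesis using X(1) by (auto simp: convex_on_def)
qed

lemma continuous_objective: "continuous_on (X \<inter> interior D) F"
proof -
  have "continuous_on (interior D) (f i)" for i
    using f[of i] by (intro convex_on_continuous convex_on_subset[OF f]) (auto simp: interior_subset convex_on_def)
  then have "continuous_on (X \<inter> interior D) (f i)" for i by (rule continuous_on_subset) auto
  moreover have "continuous_on (X \<inter> interior D) (\<psi> i)" for i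
  proof -
    obtain d where d: "d > 0" "\<And>x. N x \<le> d * norm x" using le_euclidean by blast
    have "\<bar>\<psi> i y - \<psi> i z\<bar> \<le> (G\<psi> * d) * norm (y - z)" if "y \<in> X" "z \<in> X" for y z
    proof -
      have "G\<psi> * N (y - z) \<le> G\<psi> * (d * norm (y - z))" using G\<psi>_pos d(2) by simp
      then show ?thesis using \<psi>_Lipschitz[OF that, of i] by (simp only: mult.assoc)
    qed
    then have "(G\<psi> * d)-lipschitz_on (X \<inter> interior D) (\<psi> i)"
      using G\<psi>_pos d(1) by (auto simp: lipschitz_on_def dist_norm)
    then show ?thesis by (rule lipschitz_on_continuous_on)
  qed
  ultimately show ?thesis unfolding F by (intro continuous_intros)
qed

end

section \<open>Sub-Weibull martingale differences\<close>

text \<open>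
  With \<open>s = v powr (1 / \<theta>)\<close> the left-hand side is \<open>s powr (2 * \<theta>)\<close>, which an exponential dominates.
\<close>

lemma square_le_exp_powr:
  fixes \<theta> :: real
  assumes "\<theta> > 0"
  shows "\<exists>c\<ge>0. \<forall>v\<ge>0. v\<^sup>2 \<le> c * exp (v powr (1 / \<theta>) / 2)"
proof -
  define k where "k = nat \<lceil>2 * \<theta>\<rceil>"
  define c :: real where "c = fact k * 2 ^ k"
  have c: "c \<ge> 1" using mult_mono[of 1 "fact k :: real" 1 "2 ^ k"] by (simp add: c_def)
  have "v\<^sup>2 \<le> c * exp (v powr (1 / \<theta>) / 2)" if "v \<ge> 0" for v :: real
  proof (cases "v \<ge> 1")
    case True
    define s where "s = v powr (1 / \<theta>)"
    have s: "s \<ge> 1" using True assms by (simp add: s_def ge_one_powr_ge_zero)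
    have v_eq: "s powr \<theta> = v" using True assms by (simp add: s_def powr_powr)
    have "v\<^sup>2 = v powr 2" using that by simp
    also have "\<dots> = s powr (\<theta> * 2)" by (simp only: v_eq powr_powr[symmetric])
    also have "\<dots> \<le> s powr real k" using s by (intro powr_mono) (simp_all add: k_def mult.commute real_nat_ceiling_ge)
    also have "\<dots> = c * ((s / 2) ^ k / fact k)"
      using s by (simp add: powr_realpow c_def power_divide)
    also have "\<dots> \<le> c * exp (s / 2)"
    proof (rule mult_left_mono)
      have "(s / 2) ^ k / fact k \<le> (\<Sum>i<Suc k. (s / 2) ^ i / fact i)"
        using s by (intro member_le_sum) auto
      also obtain t where "exp (s / 2) = (\<Sum>i<Suc k. (s / 2) ^ i / fact i) + exp t / fact (Suc k) * (s / 2) ^ Suc k"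
        using Maclaurin_exp_le by blast
      then have "(\<Sum>i<Suc k. (s / 2) ^ i / fact i) \<le> exp (s / 2)" using s by simp
      finally show "(s / 2) ^ k / fact k \<le> exp (s / 2)" .
    qed (use c in simp)
    finally show ?thesis by (simp add: s_def)
  next
    case False
    then have "v\<^sup>2 \<le> 1 * 1" using that by (simp add: power_le_one)
    also have "\<dots> \<le> c * exp (v powr (1 / \<theta>) / 2)" using c by (intro mult_mono) auto
    finally show ?thesis by simp
  qed
  then show ?thesis using c by (intro exI[of _ c]) auto
qed

lemma exp_le_quadratic: "exp w \<le> 1 + w + w\<^sup>2 * exp \<bar>w\<bar>" for w :: real
proof -
  obtain t where t: "\<bar>t\<bar> \<le> \<bar>w\<bar>" "exp w = (\<Sum>m<2. w ^ m / fact m) + exp t / fact 2 * w ^ 2"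
    using Maclaurin_exp_le by blast
  have "exp t / 2 * w\<^sup>2 \<le> exp \<bar>w\<bar> * w\<^sup>2"
  proof (rule mult_right_mono)
    have "exp t \<le> exp \<bar>w\<bar>" using t(1) by simp
    then show "exp t / 2 \<le> exp \<bar>w\<bar>" using exp_gt_zero[of t] by linarith
  qed simp
  then show ?thesis using t(2) by (simp add: numeral_2_eq_2 algebra_simps)
qed

text \<open>
  On the truncation event, \<open>v \<le> A powr max 0 (\<theta> - 1) * (1 + v powr (1 / \<theta>))\<close>, so the condition on
  \<open>\<rho>\<close> makes \<open>\<bar>w\<bar>\<close> at most half of \<open>1 + v powr (1 / \<theta>)\<close>; the other half absorbs the factor \<open>v\<^sup>2\<close> of
  the remainder in the expansion of \<open>exp w\<close>.  Off the event the left-hand side is 0 and the right-hand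
  side is nonnegative because \<open>1 + w + w\<^sup>2 \<ge> 0\<close>.  Keeping the linear term \<open>w\<close> without truncation is
  what makes centred noise drop out after integration.
\<close>

lemma truncated_exp_le:
  fixes \<theta> A v c \<rho> w :: real
  assumes \<theta>: "\<theta> \<ge> 1 / 2" and A: "A \<ge> 1" and v: "v \<ge> 0"
    and c: "c \<ge> 0" "\<And>v. v \<ge> 0 \<Longrightarrow> v\<^sup>2 \<le> c * exp (v powr (1 / \<theta>) / 2)"
    and \<rho>: "\<rho> \<ge> 0" "\<rho> * A powr max 0 (\<theta> - 1) \<le> 1 / 2"
    and w: "\<bar>w\<bar> \<le> \<rho> * v"
  shows "exp w * of_bool (v \<le> A powr \<theta>) \<le> 1 + w + 2 * c * \<rho>\<^sup>2 * exp (v powr (1 / \<theta>))"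
proof (cases "v \<le> A powr \<theta>")
  case True
  define s where "s = v powr (1 / \<theta>)"
  have v_le: "v \<le> A powr max 0 (\<theta> - 1) * (1 + s)"
  proof (cases "v \<ge> 1")
    case v1: True
    have "v = v powr (1 / \<theta>) * v powr (1 - 1 / \<theta>)" using v1 powr_add[of v "1 / \<theta>" "1 - 1 / \<theta>"] by simp
    also have "v powr (1 - 1 / \<theta>) \<le> A powr max 0 (\<theta> - 1)"
    proof (cases "\<theta> \<ge> 1")
      case t1: True
      then have "v powr (1 - 1 / \<theta>) \<le> (A powr \<theta>) powr (1 - 1 / \<theta>)"
        using True v by (intro powr_mono2) auto
      also have "\<dots> = A powr (\<theta> - 1)" using t1 by (simp add: powr_powr right_diff_distrib)
      finally show ?thesis using t1 by simp
    next
      case False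
      then have "v powr (1 - 1 / \<theta>) \<le> v powr 0" using v1 \<theta> by (intro powr_mono) auto
      then show ?thesis using False v1 A by simp
    qed
    finally have "v \<le> s * A powr max 0 (\<theta> - 1)" by (simp add: s_def mult_left_mono)
    also have "\<dots> \<le> A powr max 0 (\<theta> - 1) * (1 + s)" by (simp add: algebra_simps)
    finally show ?thesis .
  next
    case False
    have "1 * 1 \<le> A powr max 0 (\<theta> - 1) * (1 + s)"
      using A by (intro mult_mono) (auto simp: ge_one_powr_ge_zero s_def)
    then show ?thesis using False by simp
  qed
  have "\<bar>w\<bar> \<le> \<rho> * (A powr max 0 (\<theta> - 1) * (1 + s))"
    using w mult_left_mono[OF v_le \<rho>(1)] by linarith
  also have "\<dots> = (\<rho> * A powr max 0 (\<theta> - 1)) * (1 + s)" by simp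
  also have "\<dots> \<le> 1 / 2 * (1 + s)" using \<rho>(2) by (intro mult_right_mono) (auto simp: s_def)
  finally have w': "\<bar>w\<bar> \<le> 1 / 2 + s / 2" by simp
  have "w\<^sup>2 * exp \<bar>w\<bar> \<le> (\<rho> * v)\<^sup>2 * exp (1 / 2 + s / 2)"
    using w w' by (intro mult_mono) (auto simp: power2_le_iff_abs_le abs_mult \<rho> v)
  also have "\<dots> = \<rho>\<^sup>2 * exp (1 / 2) * (v\<^sup>2 * exp (s / 2))"
    by (simp add: power_mult_distrib exp_add)
  also have "\<dots> \<le> \<rho>\<^sup>2 * 2 * (c * exp (s / 2) * exp (s / 2))"
  proof (intro mult_mono)
    have "exp (1 / 2 :: real) \<le> 1 + 1 / 2 + (1 / 2)\<^sup>2" by (rule exp_bound) auto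
    then show "exp (1 / 2 :: real) \<le> 2" by (simp add: power2_eq_square)
    show "v\<^sup>2 \<le> c * exp (s / 2)" unfolding s_def by (rule c(2)[OF v])
  qed (use c in auto)
  also have "exp (s / 2) * exp (s / 2) = exp s" by (simp flip: exp_add)
  then have "\<rho>\<^sup>2 * 2 * (c * exp (s / 2) * exp (s / 2)) = 2 * c * \<rho>\<^sup>2 * exp s" by simp
  finally show ?thesis using True exp_le_quadratic[of w] by (simp add: s_def)
next
  case False
  have "0 \<le> 1 + w + w\<^sup>2"
  proof -
    have "0 \<le> (w + 1 / 2)\<^sup>2" by simp
    then show ?thesis by (simp add: power2_eq_square algebra_simps)
  qed
  moreover have "w\<^sup>2 \<le> 2 * c * \<rho>\<^sup>2 * exp (v powr (1 / \<theta>))"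
  proof -
    have "w\<^sup>2 \<le> (\<rho> * v)\<^sup>2" using w by (simp add: power2_le_iff_abs_le abs_mult \<rho> v)
    also have "\<dots> \<le> \<rho>\<^sup>2 * (c * exp (v powr (1 / \<theta>) / 2))"
      unfolding power_mult_distrib using c(2)[OF v] by (intro mult_left_mono) auto
    also have "\<dots> \<le> \<rho>\<^sup>2 * (2 * c * exp (v powr (1 / \<theta>)))"
    proof (intro mult_left_mono mult_mono)
      show "exp (v powr (1 / \<theta>) / 2) \<le> exp (v powr (1 / \<theta>))"
        using powr_ge_zero[of v "1 / \<theta>"] by simp
    qed (use c in auto)
    finally show ?thesis by (simp add: algebra_simps)
  qed
  ultimately show ?thesis using False by simp
qed

text \<open>
  The integrability of \<open>Z * h\<close> is part of the conclusion, since a conditional bound says nothing about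
  it in advance.
\<close>

lemma (in sigma_finite_subalgebra) integral_weighted_cond_exp_bound:
  fixes h Z :: "'a \<Rightarrow> real"
  assumes Z[measurable]: "Z \<in> borel_measurable F" and Zb: "\<And>\<omega>. 0 \<le> Z \<omega>" and intZ: "integrable M Z"
    and h[measurable]: "h \<in> borel_measurable M" and h0: "\<And>\<omega>. 0 \<le> h \<omega>"
    and c: "c \<ge> 0" "AE \<omega> in M. nn_cond_exp M F (\<lambda>\<omega>. ennreal (h \<omega>)) \<omega> \<le> ennreal c"
  shows "integrable M (\<lambda>\<omega>. Z \<omega> * h \<omega>)" "(\<integral>\<omega>. Z \<omega> * h \<omega> \<partial>M) \<le> c * (\<integral>\<omega>. Z \<omega> \<partial>M)"
proof -
  have [measurable]: "Z \<in> borel_measurable M" by (rule measurable_from_subalg[OF subalg Z])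
  have "(\<integral>\<^sup>+\<omega>. ennreal (Z \<omega> * h \<omega>) \<partial>M) = (\<integral>\<^sup>+\<omega>. ennreal (Z \<omega>) * ennreal (h \<omega>) \<partial>M)"
    using Zb h0 by (simp add: ennreal_mult)
  also have "\<dots> = (\<integral>\<^sup>+\<omega>. ennreal (Z \<omega>) * nn_cond_exp M F (\<lambda>\<omega>. ennreal (h \<omega>)) \<omega> \<partial>M)"
    by (rule nn_cond_exp_intg[symmetric]) measurable
  also have "\<dots> \<le> (\<integral>\<^sup>+\<omega>. ennreal (Z \<omega>) * ennreal c \<partial>M)"
  proof (rule nn_integral_mono_AE)
    show "AE \<omega> in M. ennreal (Z \<omega>) * nn_cond_exp M F (\<lambda>\<omega>. ennreal (h \<omega>)) \<omega> \<le> ennreal (Z \<omega>) * ennreal c"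
      using c(2) by (rule eventually_mono) (rule mult_left_mono, simp_all)
  qed
  also have "\<dots> = ennreal (c * (\<integral>\<omega>. Z \<omega> \<partial>M))"
    using c(1) Zb intZ
    by (simp add: nn_integral_multc nn_integral_eq_integral ennreal_mult integral_nonneg mult.commute[of c])
  finally have le: "(\<integral>\<^sup>+\<omega>. ennreal (Z \<omega> * h \<omega>) \<partial>M) \<le> ennreal (c * (\<integral>\<omega>. Z \<omega> \<partial>M))" .
  then show "integrable M (\<lambda>\<omega>. Z \<omega> * h \<omega>)"
    using Zb h0 by (intro integrableI_nonneg) (auto intro: order_le_less_trans)
  show "(\<integral>\<omega>. Z \<omega> * h \<omega> \<partial>M) \<le> c * (\<integral>\<omega>. Z \<omega> \<partial>M)"
    using le Zb h0 c(1)
    by (intro integral_real_bounded) (auto intro!: mult_nonneg_nonneg integral_nonneg)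
qed

lemma (in sigma_finite_subalgebra) integral_inner_centred:
  fixes \<xi> u :: "'a \<Rightarrow> real ^ 'n"
  assumes u[measurable]: "u \<in> borel_measurable F" and ub: "\<And>\<omega>. norm (u \<omega>) \<le> b"
    and \<xi>: "integrable M \<xi>"
    and zero: "\<And>k. AE \<omega> in M. real_cond_exp M F (\<lambda>\<omega>. \<xi> \<omega> $ k) \<omega> = 0"
  shows "integrable M (\<lambda>\<omega>. u \<omega> \<bullet> \<xi> \<omega>)" "(\<integral>\<omega>. u \<omega> \<bullet> \<xi> \<omega> \<partial>M) = 0"
proof -
  have comp: "integrable M (\<lambda>\<omega>. u \<omega> $ k * \<xi> \<omega> $ k) \<and> (\<integral>\<omega>. u \<omega> $ k * \<xi> \<omega> $ k \<partial>M) = 0" for k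
  proof -
    have uk[measurable]: "(\<lambda>\<omega>. u \<omega> $ k) \<in> borel_measurable F"
      using borel_measurable_inner[OF u borel_measurable_const[of "axis k 1"]] by (simp add: inner_axis)
    have [measurable]: "(\<lambda>\<omega>. u \<omega> $ k) \<in> borel_measurable M" by (rule measurable_from_subalg[OF subalg uk])
    have \<xi>k: "integrable M (\<lambda>\<omega>. \<xi> \<omega> $ k)"
      using integrable_inner_left[of "axis k 1" M \<xi>] \<xi> by (simp add: inner_axis)
    have int: "integrable M (\<lambda>\<omega>. u \<omega> $ k * \<xi> \<omega> $ k)"
    proof (rule Bochner_Integration.integrable_bound)
      show "integrable M (\<lambda>\<omega>. b * \<xi> \<omega> $ k)" using \<xi>k by simp
      show "AE \<omega> in M. norm (u \<omega> $ k * \<xi> \<omega> $ k) \<le> norm (b * \<xi> \<omega> $ k)"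
      proof (rule AE_I2)
        fix \<omega>
        have "\<bar>u \<omega> $ k\<bar> \<le> \<bar>b\<bar>" using component_le_norm_cart[of "u \<omega>" k] ub[of \<omega>] by linarith
        then show "norm (u \<omega> $ k * \<xi> \<omega> $ k) \<le> norm (b * \<xi> \<omega> $ k)"
          by (simp add: abs_mult mult_right_mono)
      qed
    qed (use \<xi>k in measurable)
    have "(\<integral>\<omega>. u \<omega> $ k * \<xi> \<omega> $ k \<partial>M) = (\<integral>\<omega>. u \<omega> $ k * real_cond_exp M F (\<lambda>\<omega>. \<xi> \<omega> $ k) \<omega> \<partial>M)"
      using real_cond_exp_intg(2)[OF int uk] \<xi>k by simp
    also have "\<dots> = (\<integral>\<omega>. 0 \<partial>M)"
      by (rule integral_cong_AE) (use zero[of k] in auto)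
    finally show ?thesis using int by simp
  qed
  then show "integrable M (\<lambda>\<omega>. u \<omega> \<bullet> \<xi> \<omega>)" "(\<integral>\<omega>. u \<omega> \<bullet> \<xi> \<omega> \<partial>M) = 0"
    by (simp_all add: inner_vec_def)
qed

text \<open>
  The noise of a single agent.  Agents are treated one at a time, because the noises of different agents
  at the same time may depend on each other.
\<close>

locale sub_Weibull_noise = prob_space M + vector_norm N
  for M :: "'w measure" and N :: "real ^ 'n::finite \<Rightarrow> real" +
  fixes Fil :: "nat \<Rightarrow> 'w measure" and \<xi> :: "nat \<Rightarrow> 'w \<Rightarrow> real ^ 'n" and \<theta> \<kappa> :: real
  assumes filtration: "filtration (space M) Fil" and subalg: "\<And>t. subalgebra M (Fil t)"
    and adapted: "\<And>t. t \<ge> 1 \<Longrightarrow> \<xi> t \<in> borel_measurable (Fil t)"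
    and integrable_noise: "\<And>t. t \<ge> 1 \<Longrightarrow> integrable M (\<xi> t)"
    and centred: "\<And>t k. t \<ge> 1 \<Longrightarrow> AE \<omega> in M. real_cond_exp M (Fil (t - 1)) (\<lambda>\<omega>. \<xi> t \<omega> $ k) \<omega> = 0"
    and \<theta>: "\<theta> \<ge> 1 / 2" and \<kappa>: "\<kappa> > 0"
    and tail: "\<And>t. t \<ge> 1 \<Longrightarrow> AE \<omega> in M. nn_cond_exp M (Fil (t - 1))
          (\<lambda>\<omega>. ennreal (exp ((dual_norm N (\<xi> t \<omega>) / \<kappa>) powr (1 / \<theta>)))) \<omega> \<le> 2"
begin

lemma Fil_mono: "s \<le> t \<Longrightarrow> subalgebra (Fil t) (Fil s)"
  using filtration by (auto simp: subalgebra_def filtration_def)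

lemma sigma_finite_Fil: "sigma_finite_subalgebra M (Fil t)"
proof -
  interpret finite_measure_subalgebra M "Fil t" by unfold_locales (rule subalg)
  show ?thesis by unfold_locales
qed

lemma measurable_Fil: "h \<in> borel_measurable (Fil s) \<Longrightarrow> s \<le> t \<Longrightarrow> h \<in> borel_measurable (Fil t)"
  by (rule measurable_from_subalg[OF Fil_mono])

lemma measurable_noise [measurable]: "t \<ge> 1 \<Longrightarrow> \<xi> t \<in> borel_measurable M"
  by (rule measurable_from_subalg[OF subalg adapted])

lemma noise_tail:
  assumes t: "t \<ge> 1" and A: "A \<ge> 0"
  shows "prob {\<omega> \<in> space M. \<kappa> * A powr \<theta> < dual_norm N (\<xi> t \<omega>)} \<le> 2 * exp (- A)"
proof -
  interpret sigma_finite_subalgebra M "Fil (t - 1)" by (rule sigma_finite_Fil)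
  define h where "h \<omega> = exp ((dual_norm N (\<xi> t \<omega>) / \<kappa>) powr (1 / \<theta>))" for \<omega>
  have [measurable]: "\<xi> t \<in> borel_measurable M" using t by (rule measurable_noise)
  have hm: "h \<in> borel_measurable M" unfolding h_def by measurable
  have h: "integrable M (\<lambda>\<omega>. 1 * h \<omega>)" "(\<integral>\<omega>. 1 * h \<omega> \<partial>M) \<le> 2 * (\<integral>\<omega>. 1 \<partial>M)"
    by (rule integral_weighted_cond_exp_bound[where c = 2]; use hm tail[OF t] in \<open>simp add: h_def\<close>)+
  have "{\<omega> \<in> space M. \<kappa> * A powr \<theta> < dual_norm N (\<xi> t \<omega>)} \<subseteq> {\<omega> \<in> space M. exp A \<le> h \<omega>}"
  proof clarify
    fix \<omega> assume "\<kappa> * A powr \<theta> < dual_norm N (\<xi> t \<omega>)"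
    then have "A powr \<theta> \<le> dual_norm N (\<xi> t \<omega>) / \<kappa>" using \<kappa> by (simp add: field_simps)
    then have "(A powr \<theta>) powr (1 / \<theta>) \<le> (dual_norm N (\<xi> t \<omega>) / \<kappa>) powr (1 / \<theta>)"
      using \<theta> by (intro powr_mono2) auto
    then show "exp A \<le> h \<omega>" using \<theta> A by (simp add: powr_powr h_def)
  qed
  then have "prob {\<omega> \<in> space M. \<kappa> * A powr \<theta> < dual_norm N (\<xi> t \<omega>)} \<le> prob {\<omega> \<in> space M. exp A \<le> h \<omega>}"
    using hm by (intro finite_measure_mono) auto
  also have "\<dots> \<le> (\<integral>\<omega>. h \<omega> \<partial>M) / exp A"
    using h by (intro integral_Markov_inequality_measure[where A = "{}"]) (auto simp: h_def)
  also have "\<dots> \<le> 2 / exp A" using h by (intro divide_right_mono) (simp_all add: prob_space)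
  finally show ?thesis by (simp add: exp_minus field_simps)
qed

context
  fixes u :: "nat \<Rightarrow> 'w \<Rightarrow> real ^ 'n" and r :: "nat \<Rightarrow> real" and A c :: real
  assumes predictable: "\<And>t. t \<ge> 1 \<Longrightarrow> u t \<in> borel_measurable (Fil (t - 1))"
    and u_le: "\<And>t \<omega>. t \<ge> 1 \<Longrightarrow> N (u t \<omega>) \<le> r t"
    and A: "A \<ge> 1" and r_le: "\<And>t. t \<ge> 1 \<Longrightarrow> r t * \<kappa> * A powr max 0 (\<theta> - 1) \<le> 1 / 2"
    and c: "c \<ge> 0" "\<And>v. v \<ge> 0 \<Longrightarrow> v\<^sup>2 \<le> c * exp (v powr (1 / \<theta>) / 2)"
begin

text \<open>
  The exponential of the martingale, killed when the noise first exceeds the truncation level.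
  For each \<open>n\<close> this is a bounded variable, even though the martingale itself need not have exponential moments.
\<close>

definition truncated_exp :: "nat \<Rightarrow> 'w \<Rightarrow> real" where
  "truncated_exp n \<omega> = exp (\<Sum>t=1..n. u t \<omega> \<bullet> \<xi> t \<omega>) *
     of_bool (\<forall>t\<in>{1..n}. dual_norm N (\<xi> t \<omega>) \<le> \<kappa> * A powr \<theta>)"

lemma truncated_exp_Suc:
  "truncated_exp (Suc n) \<omega> = truncated_exp n \<omega> *
     (exp (u (Suc n) \<omega> \<bullet> \<xi> (Suc n) \<omega>) * of_bool (dual_norm N (\<xi> (Suc n) \<omega>) / \<kappa> \<le> A powr \<theta>))"
  using \<kappa> by (auto simp: truncated_exp_def exp_add atLeastAtMostSuc_conv field_simps)

lemma truncated_exp_measurable: "truncated_exp n \<in> borel_measurable (Fil n)"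
proof (induction n)
  case 0
  then show ?case by (simp add: truncated_exp_def)
next
  case (Suc n)
  have [measurable]: "truncated_exp n \<in> borel_measurable (Fil (Suc n))"
      "u (Suc n) \<in> borel_measurable (Fil (Suc n))" "\<xi> (Suc n) \<in> borel_measurable (Fil (Suc n))"
    using measurable_Fil[OF Suc] measurable_Fil[OF predictable[of "Suc n"]] adapted by auto
  show ?case unfolding truncated_exp_Suc by measurable
qed

lemma r_nonneg: "t \<ge> 1 \<Longrightarrow> 0 \<le> r t"
  using u_le nonneg order_trans by blast

lemma inner_noise_le: "t \<ge> 1 \<Longrightarrow> \<bar>u t \<omega> \<bullet> \<xi> t \<omega>\<bar> \<le> r t * \<kappa> * (dual_norm N (\<xi> t \<omega>) / \<kappa>)"
proof -
  assume t: "t \<ge> 1"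
  have "\<bar>u t \<omega> \<bullet> \<xi> t \<omega>\<bar> \<le> dual_norm N (\<xi> t \<omega>) * N (u t \<omega>)"
    using dual_ineq[of "\<xi> t \<omega>" "u t \<omega>"] by (simp add: inner_commute)
  also have "\<dots> \<le> dual_norm N (\<xi> t \<omega>) * r t" using u_le[OF t] by (simp add: mult_left_mono)
  finally show ?thesis using \<kappa> by (simp add: mult.commute)
qed

lemma truncated_exp_bounded: "\<exists>b. \<forall>\<omega>. 0 \<le> truncated_exp n \<omega> \<and> truncated_exp n \<omega> \<le> b"
proof (induction n)
  case 0
  then show ?case by (auto simp: truncated_exp_def)
next
  case (Suc n)
  then obtain b where b: "\<And>\<omega>. 0 \<le> truncated_exp n \<omega>" "\<And>\<omega>. truncated_exp n \<omega> \<le> b" by blast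
  let ?q = "r (Suc n) * \<kappa> * A powr \<theta>"
  have "exp (u (Suc n) \<omega> \<bullet> \<xi> (Suc n) \<omega>) * of_bool (dual_norm N (\<xi> (Suc n) \<omega>) / \<kappa> \<le> A powr \<theta>) \<le> exp ?q" for \<omega>
  proof (cases "dual_norm N (\<xi> (Suc n) \<omega>) / \<kappa> \<le> A powr \<theta>")
    case True
    then have "r (Suc n) * \<kappa> * (dual_norm N (\<xi> (Suc n) \<omega>) / \<kappa>) \<le> ?q"
      using r_nonneg \<kappa> by (intro mult_left_mono) auto
    then show ?thesis using True inner_noise_le[of "Suc n" \<omega>] by simp
  qed simp
  then have "0 \<le> truncated_exp (Suc n) \<omega> \<and> truncated_exp (Suc n) \<omega> \<le> b * exp ?q" for \<omega>
    unfolding truncated_exp_Suc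
    using b(1)[of \<omega>] b(2)[of \<omega>] by (intro conjI mult_mono mult_nonneg_nonneg) (auto intro: order_trans)
  then show ?case by blast
qed

lemma truncated_exp_integrable: "integrable M (truncated_exp n)"
proof -
  obtain b where "\<And>\<omega>. 0 \<le> truncated_exp n \<omega>" "\<And>\<omega>. truncated_exp n \<omega> \<le> b"
    using truncated_exp_bounded by blast
  then show ?thesis
    using measurable_from_subalg[OF subalg truncated_exp_measurable]
    by (intro integrable_const_bound[where B = b]) auto
qed

lemma truncated_exp_moment_step:
  "(\<integral>\<omega>. truncated_exp (Suc n) \<omega> \<partial>M) \<le> exp (4 * c * (r (Suc n) * \<kappa>)\<^sup>2) * (\<integral>\<omega>. truncated_exp n \<omega> \<partial>M)"
proof -
  interpret sigma_finite_subalgebra M "Fil n" by (rule sigma_finite_Fil)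
  let ?Z = "truncated_exp n" and ?u = "u (Suc n)" and ?\<xi> = "\<xi> (Suc n)" and ?\<rho> = "r (Suc n) * \<kappa>"
  define h where "h \<omega> = exp ((dual_norm N (?\<xi> \<omega>) / \<kappa>) powr (1 / \<theta>))" for \<omega>
  have [measurable]: "?\<xi> \<in> borel_measurable M" by (rule measurable_noise) simp
  have hm[measurable]: "h \<in> borel_measurable M" unfolding h_def by measurable
  obtain b where Zb: "\<And>\<omega>. 0 \<le> ?Z \<omega>" "\<And>\<omega>. ?Z \<omega> \<le> b"
    using truncated_exp_bounded by blast
  have [measurable]: "?u \<in> borel_measurable (Fil n)" "?Z \<in> borel_measurable (Fil n)"
    using predictable[of "Suc n"] truncated_exp_measurable by auto
  have h: "integrable M (\<lambda>\<omega>. ?Z \<omega> * h \<omega>)" "(\<integral>\<omega>. ?Z \<omega> * h \<omega> \<partial>M) \<le> 2 * (\<integral>\<omega>. ?Z \<omega> \<partial>M)"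
    by (rule integral_weighted_cond_exp_bound[where c = 2];
        use hm tail[of "Suc n"] Zb truncated_exp_integrable in \<open>simp add: h_def\<close>)+
  obtain d where d: "d > 0" "\<And>x. norm x \<le> d * N x" using euclidean_le by blast
  have ub: "norm (?Z \<omega> *\<^sub>R ?u \<omega>) \<le> b * (d * r (Suc n))" for \<omega>
  proof -
    have "norm (?u \<omega>) \<le> d * r (Suc n)"
      by (rule order_trans[OF d(2)]) (use d(1) u_le[of "Suc n" \<omega>] in simp)
    then have "?Z \<omega> * norm (?u \<omega>) \<le> b * (d * r (Suc n))"
      using Zb[of \<omega>] by (intro mult_mono) auto
    then show ?thesis using Zb(1)[of \<omega>] by simp
  qed
  have mu: "(\<lambda>\<omega>. ?Z \<omega> *\<^sub>R ?u \<omega>) \<in> borel_measurable (Fil n)" by measurable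
  have w: "integrable M (\<lambda>\<omega>. (?Z \<omega> *\<^sub>R ?u \<omega>) \<bullet> ?\<xi> \<omega>)" "(\<integral>\<omega>. (?Z \<omega> *\<^sub>R ?u \<omega>) \<bullet> ?\<xi> \<omega> \<partial>M) = 0"
    using integral_inner_centred[OF mu ub integrable_noise[of "Suc n"]] centred[of "Suc n"] by simp_all
  have "(\<integral>\<omega>. truncated_exp (Suc n) \<omega> \<partial>M)
      \<le> (\<integral>\<omega>. ?Z \<omega> + (?Z \<omega> *\<^sub>R ?u \<omega>) \<bullet> ?\<xi> \<omega> + 2 * c * ?\<rho>\<^sup>2 * (?Z \<omega> * h \<omega>) \<partial>M)"
  proof (rule integral_mono)
    fix \<omega>
    have "exp (?u \<omega> \<bullet> ?\<xi> \<omega>) * of_bool (dual_norm N (?\<xi> \<omega>) / \<kappa> \<le> A powr \<theta>)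
        \<le> 1 + ?u \<omega> \<bullet> ?\<xi> \<omega> + 2 * c * ?\<rho>\<^sup>2 * h \<omega>"
      unfolding h_def
      by (rule truncated_exp_le[OF \<theta> A _ c]) (use \<kappa> r_nonneg r_le inner_noise_le in simp_all)
    then have "truncated_exp (Suc n) \<omega> \<le> ?Z \<omega> * (1 + ?u \<omega> \<bullet> ?\<xi> \<omega> + 2 * c * ?\<rho>\<^sup>2 * h \<omega>)"
      unfolding truncated_exp_Suc using Zb(1) by (rule mult_left_mono)
    then show "truncated_exp (Suc n) \<omega> \<le> ?Z \<omega> + (?Z \<omega> *\<^sub>R ?u \<omega>) \<bullet> ?\<xi> \<omega> + 2 * c * ?\<rho>\<^sup>2 * (?Z \<omega> * h \<omega>)"
      by (simp add: algebra_simps)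
  qed (use h w truncated_exp_integrable in auto)
  also have "\<dots> = (\<integral>\<omega>. ?Z \<omega> \<partial>M) + 2 * c * ?\<rho>\<^sup>2 * (\<integral>\<omega>. ?Z \<omega> * h \<omega> \<partial>M)"
    using h w truncated_exp_integrable by simp
  also have "\<dots> \<le> (\<integral>\<omega>. ?Z \<omega> \<partial>M) + 2 * c * ?\<rho>\<^sup>2 * (2 * (\<integral>\<omega>. ?Z \<omega> \<partial>M))"
    by (intro add_left_mono mult_left_mono h(2)) (simp add: c(1))
  also have "\<dots> = (1 + 4 * c * ?\<rho>\<^sup>2) * (\<integral>\<omega>. ?Z \<omega> \<partial>M)" by (simp add: algebra_simps)
  also have "\<dots> \<le> exp (4 * c * ?\<rho>\<^sup>2) * (\<integral>\<omega>. ?Z \<omega> \<partial>M)"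
  proof (rule mult_right_mono)
    show "1 + 4 * c * ?\<rho>\<^sup>2 \<le> exp (4 * c * ?\<rho>\<^sup>2)" by (rule exp_ge_add_one_self)
    show "0 \<le> (\<integral>\<omega>. ?Z \<omega> \<partial>M)" by (rule Bochner_Integration.integral_nonneg) (rule Zb(1))
  qed
  finally show ?thesis .
qed

lemma truncated_exp_moment:
  "(\<integral>\<omega>. truncated_exp n \<omega> \<partial>M) \<le> exp (4 * c * (\<Sum>t=1..n. (r t * \<kappa>)\<^sup>2))"
proof (induction n)
  case 0
  then show ?case by (simp add: truncated_exp_def prob_space)
next
  case (Suc n)
  have "(\<integral>\<omega>. truncated_exp (Suc n) \<omega> \<partial>M)
      \<le> exp (4 * c * (r (Suc n) * \<kappa>)\<^sup>2) * exp (4 * c * (\<Sum>t=1..n. (r t * \<kappa>)\<^sup>2))"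
    by (rule order_trans[OF truncated_exp_moment_step mult_left_mono[OF Suc]]) simp
  then show ?case by (simp add: distrib_left exp_add mult.commute)
qed

lemma truncated_martingale_tail:
  "prob {\<omega> \<in> space M. K \<le> (\<Sum>t=1..n. u t \<omega> \<bullet> \<xi> t \<omega>) \<and>
      (\<forall>t\<in>{1..n}. dual_norm N (\<xi> t \<omega>) \<le> \<kappa> * A powr \<theta>)}
    \<le> exp (4 * c * (\<Sum>t=1..n. (r t * \<kappa>)\<^sup>2) - K)"
proof -
  have mm: "truncated_exp n \<in> borel_measurable M"
    by (rule measurable_from_subalg[OF subalg truncated_exp_measurable])
  have "prob {\<omega> \<in> space M. K \<le> (\<Sum>t=1..n. u t \<omega> \<bullet> \<xi> t \<omega>) \<and>
      (\<forall>t\<in>{1..n}. dual_norm N (\<xi> t \<omega>) \<le> \<kappa> * A powr \<theta>)}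
    \<le> prob {\<omega> \<in> space M. exp K \<le> truncated_exp n \<omega>}"
  proof (rule finite_measure_mono, clarify)
    fix \<omega>
    assume "K \<le> (\<Sum>t=1..n. u t \<omega> \<bullet> \<xi> t \<omega>)"
      and small: "\<forall>t\<in>{1..n}. dual_norm N (\<xi> t \<omega>) \<le> \<kappa> * A powr \<theta>"
    then have "exp K \<le> exp (\<Sum>t=1..n. u t \<omega> \<bullet> \<xi> t \<omega>)" by (simp only: exp_le_cancel_iff)
    also have "\<dots> = truncated_exp n \<omega>"
      unfolding truncated_exp_def using small by simp
    finally show "exp K \<le> truncated_exp n \<omega>" .
  next
    show "{\<omega> \<in> space M. exp K \<le> truncated_exp n \<omega>} \<in> sets M" using mm by measurable
  qed
  also have "\<dots> \<le> (\<integral>\<omega>. truncated_exp n \<omega> \<partial>M) / exp K"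
    using truncated_exp_integrable truncated_exp_bounded[of n]
    by (intro integral_Markov_inequality_measure[where A = "{}"]) auto
  also have "\<dots> \<le> exp (4 * c * (\<Sum>t=1..n. (r t * \<kappa>)\<^sup>2)) / exp K"
    by (intro divide_right_mono truncated_exp_moment) simp
  finally show ?thesis by (simp add: exp_diff)
qed

end

end

section \<open>Numerical rate\<close>

text \<open>
  The sum of the squared stepsizes multiplies both the disagreement and the squared subgradients in the
  energy inequality, and so contributes a factor \<open>log T\<close> there.
\<close>

lemma harmonic_tail_le_ln: "(\<Sum>t=1..n. (1 / sqrt (real t + 1))\<^sup>2) \<le> ln (real n + 1)"
proof (induction n)
  case (Suc n)
  have "ln ((real n + 1) / (real n + 2)) \<le> (real n + 1) / (real n + 2) - 1"
    by (rule ln_le_minus_one) simp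
  also have "\<dots> = - (1 / (real n + 2))" by (simp add: field_simps)
  finally have "1 / (real n + 2) \<le> ln (real n + 2) - ln (real n + 1)" by (simp add: ln_div)
  moreover have "(1 / sqrt (real (Suc n) + 1))\<^sup>2 = 1 / (real n + 2)"
    by (simp add: power_divide add.commute)
  ultimately show ?case using Suc by (simp add: add.commute)
qed simp

lemma sum_inverse_sqrt_ge:
  assumes "n \<ge> 1"
  shows "sqrt (real n) / 2 \<le> (\<Sum>t=1..n. 1 / sqrt (real t + 1))"
proof -
  have "sqrt (real n + 1) \<le> sqrt (4 * real n)" using assms by simp
  also have "\<dots> = 2 * sqrt (real n)" by (simp add: real_sqrt_mult)
  finally have "sqrt (real n) * sqrt (real n + 1) \<le> sqrt (real n) * (2 * sqrt (real n))"
    by (rule mult_left_mono) simp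
  also have "\<dots> = 2 * real n" by simp
  finally have "sqrt (real n) / 2 \<le> real n * (1 / sqrt (real n + 1))"
    by (simp add: field_simps)
  also have "\<dots> = (\<Sum>t=1..n. 1 / sqrt (real n + 1))" by simp
  also have "\<dots> \<le> (\<Sum>t=1..n. 1 / sqrt (real t + 1))"
    by (intro sum_mono divide_left_mono) auto
  finally show ?thesis .
qed

text \<open>
  Up to constants, \<open>A\<close> is \<open>L = ln (T / \<delta>)\<close> and \<open>S\<close> is at most \<open>\<tau> = ln T\<close>.  The second summand of the
  numerator is therefore of order \<open>L powr (2 * \<theta>) * \<tau>\<close>.  In the first one, \<open>L = \<tau> + l\<close> with \<open>l = ln (1 / \<delta>)\<close>
  gives \<open>(A + c * S)\<^sup>2\<close> of order \<open>\<tau>\<^sup>2 + l\<^sup>2\<close>; the part with \<open>\<tau>\<^sup>2\<close> is absorbed by the first term of the rate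
  because \<open>max 0 (\<theta> - 1) \<le> \<theta>\<close>, and the part with \<open>l\<^sup>2\<close> is the second term.
\<close>

lemma rate_bound:
  fixes E0 E1 G0 \<kappa> \<theta> c \<mu> k :: real
  assumes "E0 \<ge> 0" "E1 \<ge> 0" "G0 \<ge> 0" "\<kappa> > 0" "\<theta> \<ge> 1 / 2" "c \<ge> 0" "\<mu> \<ge> 0" "k \<ge> 1"
  shows "\<exists>C>0. \<forall>(T::nat)\<ge>10. \<forall>\<delta>::real. 0 < \<delta> \<and> \<delta> < 1 \<longrightarrow>
    (let A = ln (k * real T / \<delta>); S = \<Sum>t=1..T. (1 / sqrt (real t + 1))\<^sup>2 in
     (\<mu> * (2 * \<kappa> * A powr max 0 (\<theta> - 1) * (A + c * S))\<^sup>2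
        + 4 * (E0 + E1 * (G0 + \<kappa> * A powr \<theta>)\<^sup>2 * S + 1)) / (\<Sum>t=1..T. 1 / sqrt (real t + 1))
     \<le> C * (ln (real T / \<delta>) powr (2 * \<theta>) * (ln (real T))\<^sup>2 / sqrt (real T) +
            (ln (1 / \<delta>))\<^sup>2 * ln (real T / \<delta>) powr (2 * max 0 (\<theta> - 1)) / sqrt (real T)))"
proof -
  define a where "a = 1 + ln k"
  define p where "p = max 0 (\<theta> - 1)"
  define q0 where "q0 = 2 * G0\<^sup>2 + 2 * \<kappa>\<^sup>2 * a powr (2 * \<theta>)"
  define k0 where "k0 = 8 * \<kappa>\<^sup>2 * a powr (2 * p) * (a + 2 * c)\<^sup>2"
  define C where "C = 2 * (\<mu> * k0 + 4 * (E0 + 2 * E1 * q0 + 1))"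
  have a: "a \<ge> 1" using \<open>k \<ge> 1\<close> by (simp add: a_def)
  have p: "0 \<le> p" "2 * p \<le> 2 * \<theta>" using \<open>\<theta> \<ge> 1 / 2\<close> by (auto simp: p_def)
  have q0: "q0 \<ge> 0" and k0: "k0 \<ge> 0" by (auto simp: q0_def k0_def)
  have "0 \<le> \<mu> * k0" "0 \<le> E1 * q0" using assms q0 k0 by auto
  then have "C > 0" using assms by (simp add: C_def)
  have bound: "(\<mu> * (2 * \<kappa> * A powr p * (A + c * S))\<^sup>2
        + 4 * (E0 + E1 * (G0 + \<kappa> * A powr \<theta>)\<^sup>2 * S + 1)) / s
     \<le> C * (L powr (2 * \<theta>) * \<tau>\<^sup>2 / sqrt (real T) + l\<^sup>2 * L powr (2 * p) / sqrt (real T))"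
    if T: "T \<ge> 10" and \<delta>: "0 < \<delta>" "\<delta> < 1"
      and A_def: "A = ln (k * real T / \<delta>)" and S_def: "S = (\<Sum>t=1..T. (1 / sqrt (real t + 1))\<^sup>2)"
      and s_def: "s = (\<Sum>t=1..T. 1 / sqrt (real t + 1))"
      and L_def: "L = ln (real T / \<delta>)" and \<tau>_def: "\<tau> = ln (real T)" and l_def: "l = ln (1 / \<delta>)"
    for T :: nat and \<delta> A S s L \<tau> l :: real
  proof -
    have "exp 1 \<le> (10::real)" using exp_le by linarith
    then have \<tau>: "\<tau> \<ge> 1" unfolding \<tau>_def using T by (subst ln_ge_iff) auto
    have l: "l \<ge> 0" using \<delta> by (simp add: l_def)
    have L: "L = \<tau> + l" using T \<delta> by (simp add: L_def \<tau>_def l_def ln_div)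
    have L1: "L \<ge> 1" using L \<tau> l by simp
    have A: "A = ln k + L" using T \<delta> \<open>k \<ge> 1\<close> by (simp add: A_def L_def ln_div ln_mult)
    have A0: "0 \<le> A" using A L1 \<open>k \<ge> 1\<close> by simp
    have AL: "A \<le> a * L"
      using A mult_left_mono[OF L1, of "ln k"] \<open>k \<ge> 1\<close> by (simp add: a_def distrib_right)
    have Apow: "A powr r \<le> a powr r * L powr r" if "r \<ge> 0" for r
      using powr_mono2[OF that A0 AL] a L1 by (simp add: powr_mult)
    have S: "0 \<le> S" "S \<le> 2 * \<tau>"
    proof -
      show "0 \<le> S" unfolding S_def by (intro sum_nonneg) auto
      have "S \<le> ln (real T + 1)" unfolding S_def by (rule harmonic_tail_le_ln)
      also have "\<dots> \<le> ln ((real T)\<^sup>2)"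
      proof -
        have "real T + 1 \<le> 10 * real T" using T by simp
        also have "\<dots> \<le> real T * real T" using T by (intro mult_right_mono) auto
        finally show ?thesis using T by (simp add: power2_eq_square)
      qed
      also have "\<dots> = 2 * \<tau>" using T by (simp add: \<tau>_def ln_realpow)
      finally show "S \<le> 2 * \<tau>" .
    qed
    define U where "U = L powr (2 * \<theta>) * \<tau>\<^sup>2"
    define V where "V = l\<^sup>2 * L powr (2 * p)"
    have V0: "V \<ge> 0" by (simp add: V_def)
    have L\<theta>: "L powr (2 * \<theta>) \<ge> 1" using L1 \<open>\<theta> \<ge> 1 / 2\<close> by (simp add: ge_one_powr_ge_zero)
    have \<tau>2: "\<tau> \<le> \<tau>\<^sup>2" using \<tau> by (simp add: power2_eq_square)
    then have "\<tau>\<^sup>2 \<ge> 1" using \<tau> by linarith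
    then have U1: "U \<ge> 1" unfolding U_def using mult_mono[OF L\<theta> \<open>\<tau>\<^sup>2 \<ge> 1\<close>] by simp
    have sq_add: "(y + z)\<^sup>2 \<le> 2 * y\<^sup>2 + 2 * z\<^sup>2" for y z :: real
      using zero_le_power2[of "y - z"] by (simp add: power2_eq_square algebra_simps)
    have combine: "y + 4 * (e + z + 1) \<le> y' + 4 * (e' + z')"
      if "y \<le> y'" "z \<le> z'" "e + 1 \<le> e'" for y y' z z' e e' :: real
      using that by argo
    have "(2 * \<kappa> * A powr p * (A + c * S))\<^sup>2 \<le> k0 * (U + V)"
    proof -
      have "A + c * S \<le> a * L + c * (2 * \<tau>)" using AL S \<open>c \<ge> 0\<close> by (intro add_mono mult_left_mono)
      also have "\<dots> = (a + 2 * c) * \<tau> + a * l" by (simp add: L algebra_simps)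
      also have "\<dots> \<le> (a + 2 * c) * \<tau> + (a + 2 * c) * l"
        using l \<open>c \<ge> 0\<close> by (intro add_left_mono mult_right_mono) auto
      finally have "A + c * S \<le> (a + 2 * c) * (\<tau> + l)" by (simp add: distrib_left)
      then have "(A + c * S)\<^sup>2 \<le> ((a + 2 * c) * (\<tau> + l))\<^sup>2"
        using A0 S \<open>c \<ge> 0\<close> by (intro power_mono) auto
      also have "\<dots> \<le> (a + 2 * c)\<^sup>2 * (2 * \<tau>\<^sup>2 + 2 * l\<^sup>2)"
        unfolding power_mult_distrib by (intro mult_left_mono sq_add) auto
      finally have sq: "(A + c * S)\<^sup>2 \<le> (a + 2 * c)\<^sup>2 * (2 * \<tau>\<^sup>2 + 2 * l\<^sup>2)" .
      have "(A powr p)\<^sup>2 = A powr (2 * p)" by (simp add: power2_eq_square flip: powr_add)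
      then have "(2 * \<kappa> * A powr p * (A + c * S))\<^sup>2 = 4 * \<kappa>\<^sup>2 * (A powr (2 * p) * (A + c * S)\<^sup>2)"
        by (simp add: power_mult_distrib)
      also have "\<dots> \<le> 4 * \<kappa>\<^sup>2 * ((a powr (2 * p) * L powr (2 * p)) * ((a + 2 * c)\<^sup>2 * (2 * \<tau>\<^sup>2 + 2 * l\<^sup>2)))"
        using sq Apow[of "2 * p"] p by (intro mult_left_mono mult_mono) auto
      also have "\<dots> = k0 * (L powr (2 * p) * \<tau>\<^sup>2 + V)"
        by (simp add: k0_def V_def algebra_simps)
      also have "\<dots> \<le> k0 * (U + V)"
        unfolding U_def using k0 L1 p by (intro mult_left_mono add_right_mono mult_right_mono powr_mono) auto
      finally show ?thesis .
    qed
    then have "\<mu> * (2 * \<kappa> * A powr p * (A + c * S))\<^sup>2 \<le> \<mu> * (k0 * (U + V))"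
      using \<open>\<mu> \<ge> 0\<close> by (rule mult_left_mono)
    moreover have "E1 * (G0 + \<kappa> * A powr \<theta>)\<^sup>2 * S \<le> 2 * E1 * q0 * U"
    proof -
      have "(G0 + \<kappa> * A powr \<theta>)\<^sup>2 \<le> 2 * G0\<^sup>2 * 1 + 2 * \<kappa>\<^sup>2 * A powr (2 * \<theta>)"
        using sq_add[of G0 "\<kappa> * A powr \<theta>"]
        by (simp add: power_mult_distrib) (simp add: power2_eq_square flip: powr_add)
      also have "\<dots> \<le> 2 * G0\<^sup>2 * L powr (2 * \<theta>) + 2 * \<kappa>\<^sup>2 * (a powr (2 * \<theta>) * L powr (2 * \<theta>))"
        using Apow[of "2 * \<theta>"] L\<theta> \<open>\<theta> \<ge> 1 / 2\<close> by (intro add_mono mult_left_mono) auto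
      also have "\<dots> = q0 * L powr (2 * \<theta>)" by (simp add: q0_def algebra_simps)
      finally have "(G0 + \<kappa> * A powr \<theta>)\<^sup>2 * S \<le> (q0 * L powr (2 * \<theta>)) * (2 * \<tau>\<^sup>2)"
        using S \<tau>2 q0 by (intro mult_mono) auto
      then have "E1 * ((G0 + \<kappa> * A powr \<theta>)\<^sup>2 * S) \<le> E1 * ((q0 * L powr (2 * \<theta>)) * (2 * \<tau>\<^sup>2))"
        using \<open>E1 \<ge> 0\<close> by (rule mult_left_mono)
      then show ?thesis by (simp add: U_def algebra_simps)
    qed
    moreover have "E0 + 1 \<le> (E0 + 1) * U" using U1 \<open>E0 \<ge> 0\<close> by simp
    ultimately have "\<mu> * (2 * \<kappa> * A powr p * (A + c * S))\<^sup>2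
        + 4 * (E0 + E1 * (G0 + \<kappa> * A powr \<theta>)\<^sup>2 * S + 1)
      \<le> \<mu> * (k0 * (U + V)) + 4 * ((E0 + 1) * U + 2 * E1 * q0 * U)"
      by (rule combine)
    also have "\<dots> \<le> \<mu> * (k0 * (U + V)) + 4 * (E0 + 2 * E1 * q0 + 1) * (U + V)"
      using V0 assms q0 by (simp add: algebra_simps)
    also have "\<dots> = C * (U + V) / 2" by (simp add: C_def algebra_simps)
    finally have num: "\<mu> * (2 * \<kappa> * A powr p * (A + c * S))\<^sup>2
        + 4 * (E0 + E1 * (G0 + \<kappa> * A powr \<theta>)\<^sup>2 * S + 1) \<le> C * (U + V) / 2" .
    have "sqrt (real T) / 2 \<le> s" unfolding s_def by (rule sum_inverse_sqrt_ge) (use T in simp)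
    moreover have "sqrt (real T) > 0" using T by simp
    ultimately have "(\<mu> * (2 * \<kappa> * A powr p * (A + c * S))\<^sup>2
        + 4 * (E0 + E1 * (G0 + \<kappa> * A powr \<theta>)\<^sup>2 * S + 1)) / s \<le> (C * (U + V) / 2) / (sqrt (real T) / 2)"
      using num U1 V0 \<open>C > 0\<close> by (intro frac_le) auto
    also have "\<dots> = C * (U / sqrt (real T) + V / sqrt (real T))"
      using \<open>sqrt (real T) > 0\<close> by (simp add: field_simps)
    finally show ?thesis by (simp add: U_def V_def)
  qed
  show ?thesis
    unfolding Let_def p_def[symmetric]
    by (intro exI[of _ C] conjI allI impI \<open>C > 0\<close>) (elim conjE, rule bound, simp_all)
qed

section \<open>High-probability bound\<close>

locale stochastic_run = composite_problem W B \<eta> N X D f \<psi> F \<Phi> G\<Phi> \<alpha> x1 xs \<sigma> G G\<psi> + prob_space M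
  for W :: "nat \<Rightarrow> real ^ 'm ^ 'm::finite" and B \<eta>
    and N :: "real ^ 'n::finite \<Rightarrow> real"
    and X D f \<psi> F \<Phi> G\<Phi> \<alpha> x1 xs \<sigma> G G\<psi>
    and M :: "'w measure" +
  fixes Fil x g \<xi> and \<theta> \<kappa> :: real
  assumes step_le_1: "\<And>t. t \<ge> 1 \<Longrightarrow> \<alpha> t \<le> 1"
    and algorithm: "dcsmd_sw X D f \<psi> \<Phi> G\<Phi> W \<alpha> x1 M Fil x g \<xi>"
    and noise: "noise_assumption N \<theta> \<kappa> M Fil \<xi>"
begin

lemma sub_Weibull: "sub_Weibull_noise M N Fil (\<xi> i) \<theta> \<kappa>"
proof (intro sub_Weibull_noise.intro sub_Weibull_noise_axioms.intro)
  show "prob_space M" "vector_norm N" by unfold_locales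
  show "filtration (space M) Fil" "subalgebra M (Fil t)" for t
    using algorithm unfolding dcsmd_sw_def by blast+
  show "\<xi> i t \<in> borel_measurable (Fil t)" "integrable M (\<xi> i t)"
    "AE \<omega> in M. real_cond_exp M (Fil (t - 1)) (\<lambda>\<omega>. \<xi> i t \<omega> $ k) \<omega> = 0" if "t \<ge> 1" for t k
    using algorithm that unfolding dcsmd_sw_def by blast+
  show "1 / 2 \<le> \<theta>" "0 < \<kappa>" using noise unfolding noise_assumption_def by blast+
  show "AE \<omega> in M. nn_cond_exp M (Fil (t - 1))
      (\<lambda>\<omega>. ennreal (exp ((dual_norm N (\<xi> i t \<omega>) / \<kappa>) powr (1 / \<theta>)))) \<omega> \<le> 2" if "t \<ge> 1" for t
    using noise that unfolding noise_assumption_def by blast+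
qed

lemma predictable: "t \<ge> 1 \<Longrightarrow> x i t \<in> borel_measurable (Fil (t - 1))"
  using algorithm by (simp add: dcsmd_sw_def)

lemma x_measurable: "t \<ge> 1 \<Longrightarrow> x i t \<in> borel_measurable M"
  using measurable_from_subalg[OF sub_Weibull_noise.subalg[OF sub_Weibull] predictable] .

lemma mixed_eq: "mixed W x i t \<omega> = mix t (\<lambda>j. x j t \<omega>) i"
  by (simp add: mixed_def mix_def)

lemma run_at: "\<omega> \<in> space M \<Longrightarrow> run (\<lambda>t i. x i t \<omega>) (\<lambda>t i. g i t \<omega>) (\<lambda>t i. \<xi> i t \<omega>)"
  using algorithm unfolding dcsmd_sw_def run_def mixed_eq by simp

lemma direction_measurable:
  assumes t: "t \<ge> 1"
  shows "(\<lambda>\<omega>. stopped_direction R t (mixed W x i t \<omega>)) \<in> borel_measurable (Fil (t - 1))"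
proof -
  have [measurable]: "x j t \<in> borel_measurable (Fil (t - 1))" for j using t by (rule predictable)
  show ?thesis unfolding stopped_direction_def mixed_def by measurable
qed

text \<open>
  A Chernoff bound.  The multiplier \<open>lam\<close> is as large as the smallness condition of \<open>truncated_exp_le\<close>
  allows for stepsizes up to 1.  The variance term is then at most \<open>c * S\<close>, so the
  threshold need only exceed it by \<open>A\<close> in units of \<open>1 / lam\<close>.
\<close>

lemma stopped_sum_tail:
  fixes n :: nat
  assumes A: "A \<ge> 1" and R: "R > 0"
    and c: "c \<ge> 0" "\<And>v. v \<ge> 0 \<Longrightarrow> v\<^sup>2 \<le> c * exp (v powr (1 / \<theta>) / 2)"
  defines "S \<equiv> \<Sum>t=1..n. (\<alpha> t)\<^sup>2"
  shows "prob {\<omega> \<in> space M.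
      2 * \<kappa> * A powr max 0 (\<theta> - 1) * (A + c * S) * R
        \<le> (\<Sum>t=1..n. stopped_direction R t (mixed W x i t \<omega>) \<bullet> \<xi> i t \<omega>) \<and>
      (\<forall>t\<in>{1..n}. dual_norm N (\<xi> i t \<omega>) \<le> \<kappa> * A powr \<theta>)} \<le> exp (- A)"
proof -
  interpret noise: sub_Weibull_noise M N Fil "\<xi> i" \<theta> \<kappa> by (rule sub_Weibull)
  define P where "P = A powr max 0 (\<theta> - 1)"
  define lam where "lam = 1 / (2 * \<kappa> * P * R)"
  define r where "r t = \<alpha> t / (2 * \<kappa> * P)" for t
  define u where "u t \<omega> = lam *\<^sub>R stopped_direction R t (mixed W x i t \<omega>)" for t \<omega>
  have P: "P \<ge> 1" unfolding P_def using A by (simp add: ge_one_powr_ge_zero)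
  have \<kappa>: "\<kappa> > 0" by (rule noise.\<kappa>)
  have lam: "lam > 0" using P R \<kappa> by (simp add: lam_def)
  have u_meas: "u t \<in> borel_measurable (Fil (t - 1))" if "t \<ge> 1" for t
    unfolding u_def using direction_measurable[OF that] by measurable
  have u_le: "N (u t \<omega>) \<le> r t" if t: "t \<ge> 1" for t \<omega>
  proof -
    have "N (stopped_direction R t y) \<le> \<alpha> t * R" for y
      using step_pos[OF t] R by (auto simp: stopped_direction_def scale)
    then have "N (u t \<omega>) \<le> lam * (\<alpha> t * R)" using lam by (simp add: u_def scale)
    also have "\<dots> = r t" using R by (simp add: lam_def r_def)
    finally show ?thesis .
  qed
  have r\<kappa>: "r t * \<kappa> = \<alpha> t / (2 * P)" for t using \<kappa> by (simp add: r_def)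
  have r_le: "r t * \<kappa> * A powr max 0 (\<theta> - 1) \<le> 1 / 2" if "t \<ge> 1" for t
    unfolding r\<kappa> using step_le_1[OF that] P by (simp add: P_def)
  have "(\<Sum>t=1..n. (r t * \<kappa>)\<^sup>2) = S / (4 * P\<^sup>2)"
    unfolding r\<kappa> S_def by (simp add: power_divide power_mult_distrib sum_divide_distrib)
  also have "\<dots> \<le> S / 4"
    using P by (intro divide_left_mono) (auto simp: S_def intro: sum_nonneg one_le_power)
  finally have var: "4 * c * (\<Sum>t=1..n. (r t * \<kappa>)\<^sup>2) \<le> c * S"
    using mult_left_mono[of _ _ "4 * c"] c(1) by fastforce
  have "lam * (2 * \<kappa> * P * (A + c * S) * R) = A + c * S"
    using \<kappa> P R by (simp add: lam_def)
  then have scaled: "2 * \<kappa> * P * (A + c * S) * R \<le> z \<longleftrightarrow> A + c * S \<le> lam * z" for z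
    using mult_le_cancel_left_pos[OF lam] by metis
  have "(\<Sum>t=1..n. u t \<omega> \<bullet> \<xi> i t \<omega>)
      = lam * (\<Sum>t=1..n. stopped_direction R t (mixed W x i t \<omega>) \<bullet> \<xi> i t \<omega>)" for \<omega>
    by (simp add: u_def sum_distrib_left)
  then have "prob {\<omega> \<in> space M.
      2 * \<kappa> * P * (A + c * S) * R \<le> (\<Sum>t=1..n. stopped_direction R t (mixed W x i t \<omega>) \<bullet> \<xi> i t \<omega>) \<and>
      (\<forall>t\<in>{1..n}. dual_norm N (\<xi> i t \<omega>) \<le> \<kappa> * A powr \<theta>)}
    \<le> exp (4 * c * (\<Sum>t=1..n. (r t * \<kappa>)\<^sup>2) - (A + c * S))"
    using noise.truncated_martingale_tail[OF u_meas u_le A r_le c, of "A + c * S" n]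
    unfolding scaled by simp
  also have "\<dots> \<le> exp (- A)" using var by simp
  finally show ?thesis unfolding P_def .
qed

lemma average_in_domain:
  assumes \<omega>: "\<omega> \<in> space M" and T: "T \<ge> 1"
  shows "weighted_avg \<alpha> x l T \<omega> \<in> X \<inter> interior D"
    and "F (weighted_avg \<alpha> x l T \<omega>) - F xs
      \<le> (\<Sum>t=1..T. \<alpha> t * (F (x l t \<omega>) - F xs)) / (\<Sum>t=1..T. \<alpha> t)"
proof -
  let ?s = "\<Sum>t=1..T. \<alpha> t"
  have s: "?s > 0" using step_pos T by (intro sum_pos) auto
  have avg: "weighted_avg \<alpha> x l T \<omega> = (\<Sum>t=1..T. (\<alpha> t / ?s) *\<^sub>R x l t \<omega>)"
    by (simp add: weighted_avg_def scaleR_sum_right)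
  have w: "(\<Sum>t=1..T. \<alpha> t / ?s) = 1" "\<And>t. t \<in> {1..T} \<Longrightarrow> 0 \<le> \<alpha> t / ?s"
    using s step_pos by (auto simp: less_imp_le simp flip: sum_divide_distrib)
  have xX: "x l t \<omega> \<in> X" "x l t \<omega> \<in> interior D" if "t \<in> {1..T}" for t
    using x_in_X[OF run_at[OF \<omega>], of t l] x_interior[OF run_at[OF \<omega>], of t l] that by auto
  have "convex D" using f by (auto simp: convex_on_def)
  then show "weighted_avg \<alpha> x l T \<omega> \<in> X \<inter> interior D"
    unfolding avg using X(1) w xX by (intro IntI convex_sum convex_interior) auto
  have "F (weighted_avg \<alpha> x l T \<omega>) \<le> (\<Sum>t=1..T. \<alpha> t / ?s * F (x l t \<omega>))"
    unfolding avg by (rule convex_on_sum[OF _ _ convex_objective]) (use w xX T in auto)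
  also have "\<dots> = (\<Sum>t=1..T. \<alpha> t * (F (x l t \<omega>) - F xs)) / ?s + F xs"
    using s by (simp add: right_diff_distrib sum_subtractf diff_divide_distrib sum_divide_distrib
        flip: sum_distrib_right)
  finally show "F (weighted_avg \<alpha> x l T \<omega>) - F xs
      \<le> (\<Sum>t=1..T. \<alpha> t * (F (x l t \<omega>) - F xs)) / ?s" by simp
qed

text \<open>
  \<open>F\<close> is continuous on \<open>X \<inter> interior D\<close>, where the averages live, but it need not be measurable on
  the whole space.
\<close>

lemma objective_measurable:
  assumes T: "T \<ge> 1"
  shows "(\<lambda>\<omega>. F (weighted_avg \<alpha> x l T \<omega>)) \<in> borel_measurable M"
proof -
  let ?S = "X \<inter> interior D"
  have "(\<lambda>\<omega>. weighted_avg \<alpha> x l T \<omega>) \<in> borel_measurable M"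
    unfolding weighted_avg_def using x_measurable by measurable
  then have "(\<lambda>\<omega>. weighted_avg \<alpha> x l T \<omega>) \<in> measurable M (restrict_space borel ?S)"
    using average_in_domain(1)[OF _ T] by (intro measurable_restrict_space2) auto
  moreover have "F \<in> borel_measurable (restrict_space borel ?S)"
    by (rule borel_measurable_continuous_on_restrict[OF continuous_objective])
  ultimately show ?thesis by (rule measurable_compose)
qed

text \<open>
  The bad event is a union over agents and times of two kinds of events: a noise vector above the truncation
  level, of probability at most \<open>2 * exp (- A)\<close>, and a stopped sum that is too large although the
  noise is below that level, of probability at most \<open>exp (- A)\<close>.  The radius \<open>R\<close> solves the inequality
  required by \<open>bootstrap\<close>: its first summand makes the noise term at most half of \<open>\<sigma> / 2 * R\<^sup>2\<close>, and its
  second summand does the same for the remaining energy.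
\<close>

lemma gap_tail:
  assumes T: "T \<ge> 1" and A: "A \<ge> 1"
    and c: "c \<ge> 0" "\<And>v. v \<ge> 0 \<Longrightarrow> v\<^sup>2 \<le> c * exp (v powr (1 / \<theta>) / 2)"
  defines "S \<equiv> \<Sum>t=1..T. (\<alpha> t)\<^sup>2"
  shows "prob {\<omega> \<in> space M. F (weighted_avg \<alpha> x l T \<omega>) - F xs \<le>
      (16 * (real CARD('m))\<^sup>2 / \<sigma> * (2 * \<kappa> * A powr max 0 (\<theta> - 1) * (A + c * S))\<^sup>2
        + 4 * (initial_energy + energy_rate * (G + G\<psi> + \<kappa> * A powr \<theta>)\<^sup>2 * S + 1)) / (\<Sum>t=1..T. \<alpha> t)}
    \<ge> 1 - 3 * (CARD('m) * T) * exp (- A)"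
proof -
  define m where "m = real CARD('m)"
  define b where "b = \<kappa> * A powr \<theta>"
  define K where "K = 2 * \<kappa> * A powr max 0 (\<theta> - 1) * (A + c * S)"
  \<comment> \<open>the summand 1 keeps \<open>R\<close> positive\<close>
  define E where "E = initial_energy + energy_rate * (G + G\<psi> + b)\<^sup>2 * S + 1"
  define R where "R = 4 * m * K / \<sigma> + sqrt (4 * E / \<sigma>)"
  define sd where "sd i t \<omega> = stopped_direction R t (mixed W x i t \<omega>) \<bullet> \<xi> i t \<omega>" for i t \<omega>
  define large where "large i t = {\<omega> \<in> space M. b < dual_norm N (\<xi> i t \<omega>)}" for i t
  define drift where "drift i n = {\<omega> \<in> space M. 2 * \<kappa> * A powr max 0 (\<theta> - 1) * (A + c * (\<Sum>t=1..n. (\<alpha> t)\<^sup>2)) * R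
        \<le> (\<Sum>t=1..n. sd i t \<omega>) \<and> (\<forall>t\<in>{1..n}. dual_norm N (\<xi> i t \<omega>) \<le> b)}" for i n
  have m: "m \<ge> 1" by (simp add: m_def Suc_leI)
  have \<kappa>: "\<kappa> > 0" using noise by (simp add: noise_assumption_def)
  have b: "b \<ge> 0" using \<kappa> by (simp add: b_def)
  have S: "S \<ge> 0" by (simp add: S_def sum_nonneg)
  have trunc: "A powr max 0 (\<theta> - 1) \<ge> 0" by simp
  have K: "K \<ge> 0" using \<kappa> trunc A c S by (simp add: K_def)
  have E: "E > 0" using initial_energy_nonneg energy_rate_nonneg S by (simp add: E_def add_nonneg_pos)
  have R: "R > 0" using K E m \<sigma>_pos by (simp add: R_def add_nonneg_pos)
  have R_enough: "initial_energy + energy_rate * (G + G\<psi> + b)\<^sup>2 * S + m * (K * R) \<le> \<sigma> / 2 * R\<^sup>2"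
  proof -
    have "4 * m * K / \<sigma> \<le> R" using E \<sigma>_pos by (simp add: R_def)
    then have "m * K \<le> \<sigma> / 4 * R" using \<sigma>_pos by (simp add: field_simps)
    then have "m * K * R \<le> \<sigma> / 4 * R * R" using R by (intro mult_right_mono) auto
    moreover have "sqrt (4 * E / \<sigma>) \<le> R" using K m \<sigma>_pos by (simp add: R_def)
    then have "4 * E / \<sigma> \<le> R\<^sup>2" using real_sqrt_le_iff R by (metis less_imp_le real_le_rsqrt real_sqrt_abs2 real_sqrt_le_mono sqrt_le_D)
    then have "E \<le> \<sigma> / 4 * R\<^sup>2" using \<sigma>_pos by (simp add: field_simps)
    ultimately show ?thesis by (simp add: E_def power2_eq_square)
  qed
  have R_bound: "\<sigma> / 2 * R\<^sup>2 \<le> 16 * m\<^sup>2 / \<sigma> * K\<^sup>2 + 4 * E"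
  proof -
    have "R\<^sup>2 \<le> 2 * (4 * m * K / \<sigma>)\<^sup>2 + 2 * (sqrt (4 * E / \<sigma>))\<^sup>2"
      unfolding R_def using zero_le_power2[of "4 * m * K / \<sigma> - sqrt (4 * E / \<sigma>)"]
      by (simp add: power2_sum power2_diff)
    also have "\<dots> = 2 * (16 * m\<^sup>2 * K\<^sup>2 / \<sigma>\<^sup>2) + 2 * (4 * E / \<sigma>)"
      using E \<sigma>_pos by (simp add: power_mult_distrib power_divide)
    finally have "\<sigma> / 2 * R\<^sup>2 \<le> \<sigma> / 2 * (2 * (16 * m\<^sup>2 * K\<^sup>2 / \<sigma>\<^sup>2) + 2 * (4 * E / \<sigma>))"
      using \<sigma>_pos by (intro mult_left_mono) auto
    also have "\<dots> = 16 * m\<^sup>2 / \<sigma> * K\<^sup>2 + 4 * E"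
      using \<sigma>_pos by (simp add: field_simps power2_eq_square)
    finally show ?thesis .
  qed
  let ?bad = "(\<Union>i. \<Union>t\<in>{1..T}. large i t \<union> drift i t)"
  let ?good = "{\<omega> \<in> space M. F (weighted_avg \<alpha> x l T \<omega>) - F xs
    \<le> (16 * m\<^sup>2 / \<sigma> * K\<^sup>2 + 4 * E) / (\<Sum>t=1..T. \<alpha> t)}"
  have events: "large i t \<in> events" "drift i t \<in> events" if t: "t \<in> {1..T}" for i t
  proof -
    interpret noise: sub_Weibull_noise M N Fil "\<xi> i" \<theta> \<kappa> by (rule sub_Weibull)
    have [measurable]: "\<xi> i s \<in> borel_measurable M" if "s \<ge> 1" for s
      using that by (rule noise.measurable_noise)
    have [measurable]: "(\<lambda>\<omega>. stopped_direction R s (mixed W x i s \<omega>)) \<in> borel_measurable M" if "s \<ge> 1" for s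
      by (rule measurable_from_subalg[OF noise.subalg direction_measurable[OF that]])
    have [measurable]: "sd i s \<in> borel_measurable M" if "s \<ge> 1" for s
      unfolding sd_def using that by measurable
    have [measurable]: "\<xi> i t \<in> borel_measurable M" using t by (intro noise.measurable_noise) simp
    show "large i t \<in> events" unfolding large_def by measurable
    have [measurable]: "(\<lambda>\<omega>. \<Sum>s=1..t. sd i s \<omega>) \<in> borel_measurable M"
      by (intro borel_measurable_sum) auto
    have "{\<omega> \<in> space M. \<forall>s\<in>{1..t}. dual_norm N (\<xi> i s \<omega>) \<le> b} \<in> events"
      by (intro sets.sets_Collect_finite_All) auto
    then show "drift i t \<in> events" unfolding drift_def by (intro sets.sets_Collect_conj) measurable
  qed
  have "space M - ?bad \<subseteq> ?good"
  proof clarify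
    fix \<omega> assume \<omega>: "\<omega> \<in> space M" and "\<omega> \<notin> ?bad"
    then have small: "dual_norm N (\<xi> i t \<omega>) \<le> b" if "t \<in> {1..T}" for i t
      using that by (force simp: large_def not_less)
    have sums: "(\<Sum>t=1..n. sd i t \<omega>) \<le> K * R" if n: "n \<le> T" for i n
    proof (cases "n = 0")
      case False
      then have "\<omega> \<notin> drift i n" using n \<open>\<omega> \<notin> ?bad\<close> by force
      then have "(\<Sum>t=1..n. sd i t \<omega>) \<le> 2 * \<kappa> * A powr max 0 (\<theta> - 1) * (A + c * (\<Sum>t=1..n. (\<alpha> t)\<^sup>2)) * R"
        using \<omega> small n by (auto simp: drift_def)
      also have "\<dots> \<le> K * R"
        unfolding K_def S_def using n c \<kappa> trunc R
        by (intro mult_right_mono mult_left_mono add_left_mono sum_mono2) auto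
      finally show ?thesis .
    qed (use K R in simp)
    have "(\<Sum>t=1..T. \<alpha> t * (F (x l t \<omega>) - F xs)) \<le> \<sigma> / 2 * R\<^sup>2"
      using small b sums R R_enough
      by (intro bootstrap[OF run_at[OF \<omega>], where b = b and K = "K * R"])
         (auto simp: sd_def S_def m_def mixed_eq)
    also note R_bound
    finally have "(\<Sum>t=1..T. \<alpha> t * (F (x l t \<omega>) - F xs)) / (\<Sum>t=1..T. \<alpha> t)
        \<le> (16 * m\<^sup>2 / \<sigma> * K\<^sup>2 + 4 * E) / (\<Sum>t=1..T. \<alpha> t)"
      using step_pos by (intro divide_right_mono sum_nonneg) (auto simp: less_imp_le)
    then show "F (weighted_avg \<alpha> x l T \<omega>) - F xs \<le> (16 * m\<^sup>2 / \<sigma> * K\<^sup>2 + 4 * E) / (\<Sum>t=1..T. \<alpha> t)"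
      using average_in_domain(2)[OF \<omega> T, of l] by linarith
  qed
  moreover have "?good \<in> events" using objective_measurable[OF T] by measurable
  ultimately have "prob (space M - ?bad) \<le> prob ?good" by (intro finite_measure_mono)
  moreover have bad_event: "?bad \<in> events"
    using events by (intro sets.countable_UN'' sets.finite_UN) auto
  have "prob ?bad \<le> (\<Sum>i\<in>(UNIV :: 'm set). \<Sum>t=1..T. 3 * exp (- A))"
  proof -
    have "prob ?bad \<le> (\<Sum>i\<in>(UNIV :: 'm set). prob (\<Union>t\<in>{1..T}. large i t \<union> drift i t))"
      using events by (intro finite_measure_subadditive_finite) auto
    also have "\<dots> \<le> (\<Sum>i\<in>(UNIV :: 'm set). \<Sum>t=1..T. prob (large i t \<union> drift i t))"
      using events by (intro sum_mono finite_measure_subadditive_finite) auto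
    also have "\<dots> \<le> (\<Sum>i\<in>(UNIV :: 'm set). \<Sum>t=1..T. 3 * exp (- A))"
    proof (intro sum_mono)
      fix i t assume t: "t \<in> {1..T}"
      interpret noise: sub_Weibull_noise M N Fil "\<xi> i" \<theta> \<kappa> by (rule sub_Weibull)
      have "prob (large i t) \<le> 2 * exp (- A)"
        unfolding large_def b_def using t A by (intro noise.noise_tail) auto
      moreover have "prob (drift i t) \<le> exp (- A)"
        unfolding drift_def b_def sd_def by (rule stopped_sum_tail[OF A R c])
      moreover have "prob (large i t \<union> drift i t) \<le> prob (large i t) + prob (drift i t)"
        using events[OF t] by (intro measure_Un_le)
      ultimately show "prob (large i t \<union> drift i t) \<le> 3 * exp (- A)" by linarith
    qed
    finally show ?thesis .
  qed
  moreover have "prob (space M - ?bad) = 1 - prob ?bad" using bad_event by (rule prob_compl)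
  ultimately have "1 - 3 * (CARD('m) * T) * exp (- A) \<le> prob ?good" by (simp add: mult_ac)
  then show ?thesis unfolding K_def E_def b_def m_def .
qed

end

theorem theorem3:
  fixes X D :: "(real ^ 'n::finite) set"
    and N :: "real ^ 'n \<Rightarrow> real"
    and f \<psi> :: "'m::finite \<Rightarrow> real ^ 'n \<Rightarrow> real"
    and F :: "real ^ 'n \<Rightarrow> real"
    and \<Phi> :: "real ^ 'n \<Rightarrow> real"
    and G\<Phi> :: "real ^ 'n \<Rightarrow> real ^ 'n"
    and W :: "nat \<Rightarrow> real ^ 'm ^ 'm"
    and \<alpha> :: "nat \<Rightarrow> real"
    and x1 :: "'m \<Rightarrow> real ^ 'n"
    and xs :: "real ^ 'n"
    and B :: nat
    and \<eta> \<sigma> G G\<psi> \<theta> \<kappa> :: real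
  assumes "is_norm N"
    and "closed X" and "convex X"
    and "X \<subseteq> D" and "\<And>i. convex_on D (f i)" and "\<And>i. convex_on X (\<psi> i)"
    and "\<And>z. F z = (\<Sum>i\<in>UNIV. f i z) + (\<Sum>i\<in>UNIV. \<psi> i z)"
    and "xs \<in> X" and "\<And>z. z \<in> X \<Longrightarrow> F z \<ge> F xs"
    and "\<And>i. x1 i \<in> X"
    and "\<theta> \<ge> 1 / 2" and "\<kappa> > 0"
    and "network_assumption W B \<eta>"
    and "boundedness_assumption X D N f \<psi> G G\<psi>"
    and "bregman_assumption TYPE('m) X N \<sigma> \<Phi> G\<Phi>"
    and "\<And>t. t \<ge> 1 \<Longrightarrow> \<alpha> t = 1 / sqrt (real t + 1)"
  shows "\<exists>C>0. \<forall>(M :: 'w measure) Fil x g \<xi>.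
           prob_space M \<and> dcsmd_sw X D f \<psi> \<Phi> G\<Phi> W \<alpha> x1 M Fil x g \<xi> \<and>
           noise_assumption N \<theta> \<kappa> M Fil \<xi> \<longrightarrow>
           (\<forall>(T::nat)\<ge>10. \<forall>\<delta>::real. 0 < \<delta> \<and> \<delta> < 1 \<longrightarrow>
             (\<forall>l. measure M {\<omega> \<in> space M.
                F (weighted_avg \<alpha> x l T \<omega>) - F xs \<le>
                  C * (ln (real T / \<delta>) powr (2 * \<theta>) * (ln (real T))\<^sup>2 / sqrt (real T) +
                       (ln (1 / \<delta>))\<^sup>2 * ln (real T / \<delta>) powr (2 * max 0 (\<theta> - 1)) / sqrt (real T))}
                \<ge> 1 - \<delta>))"
proof -
  note step = \<open>\<And>t. t \<ge> 1 \<Longrightarrow> \<alpha> t = 1 / sqrt (real t + 1)\<close>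
  interpret composite_problem W B \<eta> N X D f \<psi> F \<Phi> G\<Phi> \<alpha> x1 xs \<sigma> G G\<psi>
  proof unfold_locales
    show "\<alpha> t \<le> \<alpha> s" if "1 \<le> s" "s \<le> t" for s t
      using that by (simp add: step frac_le)
  qed (use assms in auto)
  let ?k = "3 * real CARD('m)"
  have k: "?k \<ge> 3" by (simp add: Suc_leI)
  obtain c where c: "c \<ge> 0" "\<And>v. v \<ge> 0 \<Longrightarrow> v\<^sup>2 \<le> c * exp (v powr (1 / \<theta>) / 2)"
    using square_le_exp_powr[of \<theta>] \<open>\<theta> \<ge> 1 / 2\<close> by auto
  have coeffs: "0 \<le> G + G\<psi>" "0 \<le> 16 * (real CARD('m))\<^sup>2 / \<sigma>" "1 \<le> ?k"
    using G_pos G\<psi>_pos \<sigma>_pos k by (simp, simp, linarith)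
  obtain C where C: "C > 0" and rate: "\<And>(T::nat) \<delta>. T \<ge> 10 \<Longrightarrow> 0 < \<delta> \<and> \<delta> < 1 \<Longrightarrow>
    (let A = ln (?k * real T / \<delta>); S = \<Sum>t=1..T. (1 / sqrt (real t + 1))\<^sup>2 in
     (16 * (real CARD('m))\<^sup>2 / \<sigma> * (2 * \<kappa> * A powr max 0 (\<theta> - 1) * (A + c * S))\<^sup>2
        + 4 * (initial_energy + energy_rate * ((G + G\<psi>) + \<kappa> * A powr \<theta>)\<^sup>2 * S + 1))
        / (\<Sum>t=1..T. 1 / sqrt (real t + 1))
     \<le> C * (ln (real T / \<delta>) powr (2 * \<theta>) * (ln (real T))\<^sup>2 / sqrt (real T) +
            (ln (1 / \<delta>))\<^sup>2 * ln (real T / \<delta>) powr (2 * max 0 (\<theta> - 1)) / sqrt (real T)))"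
    using rate_bound[OF initial_energy_nonneg energy_rate_nonneg coeffs(1) \<open>\<kappa> > 0\<close> \<open>\<theta> \<ge> 1 / 2\<close>
        c(1) coeffs(2,3)] by blast
  show ?thesis
  proof (intro exI[of _ C] conjI C allI impI)
    fix M :: "'w measure" and Fil x g \<xi> and T :: nat and \<delta> :: real and l
    assume *: "prob_space M \<and> dcsmd_sw X D f \<psi> \<Phi> G\<Phi> W \<alpha> x1 M Fil x g \<xi> \<and>
           noise_assumption N \<theta> \<kappa> M Fil \<xi>" and T: "10 \<le> T" and \<delta>: "0 < \<delta> \<and> \<delta> < 1"
    interpret prob_space M using * by blast
    interpret stochastic_run W B \<eta> N X D f \<psi> F \<Phi> G\<Phi> \<alpha> x1 xs \<sigma> G G\<psi> M Fil x g \<xi> \<theta> \<kappa>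
      using * by unfold_locales (auto simp: step)
    let ?bound = "C * (ln (real T / \<delta>) powr (2 * \<theta>) * (ln (real T))\<^sup>2 / sqrt (real T) +
            (ln (1 / \<delta>))\<^sup>2 * ln (real T / \<delta>) powr (2 * max 0 (\<theta> - 1)) / sqrt (real T))"
    \<comment> \<open>chosen such that the total failure probability \<open>?k * T * exp (- A)\<close> is \<open>\<delta>\<close>\<close>
    define A where "A = ln (?k * real T / \<delta>)"
    define S where "S = (\<Sum>t=1..T. (\<alpha> t)\<^sup>2)"
    define gap where "gap = (16 * (real CARD('m))\<^sup>2 / \<sigma> * (2 * \<kappa> * A powr max 0 (\<theta> - 1) * (A + c * S))\<^sup>2
        + 4 * (initial_energy + energy_rate * (G + G\<psi> + \<kappa> * A powr \<theta>)\<^sup>2 * S + 1)) / (\<Sum>t=1..T. \<alpha> t)"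
    have kT: "3 \<le> ?k * real T / \<delta>"
    proof -
      have "3 * 1 \<le> ?k * real T" using k T by (intro mult_mono) auto
      also have "\<dots> \<le> ?k * real T / \<delta>" using \<delta> k T by (simp add: le_divide_eq mult_left_le)
      finally show ?thesis by simp
    qed
    then have "A \<ge> 1" unfolding A_def using exp_le by (subst ln_ge_iff) auto
    have "gap \<le> ?bound"
      using rate[OF T \<delta>] by (simp add: Let_def gap_def A_def S_def step)
    have "1 - \<delta> = 1 - 3 * (CARD('m) * T) * exp (- A)"
      using kT \<delta> T by (simp add: A_def exp_minus)
    also have "\<dots> \<le> prob {\<omega> \<in> space M. F (weighted_avg \<alpha> x l T \<omega>) - F xs \<le> gap}"
      unfolding gap_def S_def by (rule gap_tail[OF _ \<open>A \<ge> 1\<close> c]) (use T in auto)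
    also have "\<dots> \<le> prob {\<omega> \<in> space M. F (weighted_avg \<alpha> x l T \<omega>) - F xs \<le> ?bound}"
      using \<open>gap \<le> ?bound\<close> objective_measurable[of T l] T
      by (intro finite_measure_mono) (auto simp del: divide_le_eq)
    finally show "1 - \<delta> \<le> measure M {\<omega> \<in> space M. F (weighted_avg \<alpha> x l T \<omega>) - F xs \<le> ?bound}" .
  qed
qed

end
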